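(* Let $Y$ be a Banach space and let $Y^\star$ be its dual, equipped with the weak-$\star$ topology, with strong norm $\|\lambda\|_{Y^\star}:=\sup_{y\in Y,\ \|y\|\le1}\langle y,\lambda\rangle$. If $(\lambda_t)_{t\ge0}$ is a generalised Feller process taking values in $Y^\star$ (with respect to the weight function $\varrho(\lambda)=1+\|\lambda\|_{Y^\star}$) and $$\sup_{t\ge0}\mathbb{E}\big[\|\lambda_t\|_{Y^\star}\big]<\infty,$$ then $(\lambda_t)_{t\ge0}$ has an invariant measure.
   Context: Let $\mathbf{X}$ be a completely regular Hausdorff topological space (here $\mathbf{X}=Y^\star$ with the weak-$\star$ topology). A function $\varrho:\mathbf{X}\to(0,\infty)$ is an admissible weight function if $K_R=\{x\in\mathbf{X}:\varrho(x)\le R\}$ is compact for all $R>0$. $\mathrm{B}^\varrho(\mathbf{X})$ is the Banach space of functions $f:\mathbf{X}\to\mathbb{R}$ with $\|f\|_\varrho=\sup_{x\in\mathbf{X}}\varrho(x)^{-1}|f(x)|<\infty$, and $\mathcal{B}^\varrho(\mathbf{X})$ is the closure in $\mathrm{B}^\varrho(\mathbf{X})$ of the bounded continuous functions $\mathcal{C}_b(\mathbf{X})$. A generalised Feller semigroup is a family of bounded linear operators $P_t:\mathcal{B}^\varrho(\mathbf{X})\to\mathcal{B}^\varrho(\mathbf{X})$, $t\ge0$, such that (i) $P_0=I$; (ii) $P_{t+s}=P_tP_s$ for all $t,s\ge0$; (iii) $\lim_{t\downarrow0}P_tf(x)=f(x)$ for all $f\in\mathcal{B}^\varrho(\mathbf{X})$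 and $x\in\mathbf{X}$; (iv) there exist $C>0$ and $\varepsilon>0$ with $\|P_t\|_{L(\mathcal{B}^\varrho(\mathbf{X}))}\le C$ for all $t\in[0,\varepsilon]$; (v) $P_tf\ge0$ for every $f\in\mathcal{B}^\varrho(\mathbf{X})$ with $f\ge0$. Let $\mathcal{P}(\mathbf{X})$ be the set of probability measures on $\mathbf{X}$ and $\langle\varphi,\mu\rangle=\int_{\mathbf{X}}\varphi\,\mathrm{d}\mu$. The adjoint $P_t^\ast$ is defined by $\langle P_t\varphi,\mu\rangle=\langle\varphi,P_t^\ast\mu\rangle$ for $\varphi\in\mathcal{B}^\varrho(\mathbf{X})$, $\mu\in\mathcal{P}(\mathbf{X})$. A generalised Feller process is a Markov process $(\lambda_t)_{t\ge0}$ associated with a generalised Feller semigroup $(P_t)_{t\ge0}$: $P_t^\ast\gamma$ is the law of $\lambda_t$ whenever $\gamma$ is the law of $\lambda_0$; in particular $P_t\varphi(\lambda_0)=\mathbb{E}_{\lambda_0}[\varphi(\lambda_t)]$. A measure $\mu\in\mathcal{P}(\mathbf{X})$ is an invariant measure if $\langle P_t\varphi,\mu\rangle=\langle\varphi,\mu\rangle$ for all $t\ge0$ and all $\varphi\in\mathcal{B}^\varrho(\mathbf{X})$. *)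

theory Defs
  imports "HOL-Probability.Probability"
begin

section \<open>Weighted spaces\<close>

text \<open>
  The topology \<open>X\<close> is an explicit parameter, since the weak-star topology is not the type-class
  topology of the dual space. The points of the space are all elements of the type:
  \<open>topspace X = UNIV\<close> is understood throughout.
\<close>

definition admissible_weight :: "'x topology \<Rightarrow> ('x \<Rightarrow> real) \<Rightarrow> bool" where
  "admissible_weight X \<rho> \<longleftrightarrow>
     topspace X = UNIV \<and> completely_regular_space X \<and> Hausdorff_space X \<and>
     (\<forall>x. 0 < \<rho> x) \<and> (\<forall>R>0. compactin X {x. \<rho> x \<le> R})"

definition bounded_continuous :: "'x topology \<Rightarrow> ('x \<Rightarrow> real) set" where
  "bounded_continuous X = {f. continuous_map X euclideanreal f \<and> bounded (range f)}"

text \<open>\<open>weighted_norm \<rho> f\<close> is meaningful only for \<open>f \<in> weighted_bounded \<rho>\<close>.\<close>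

definition weighted_norm :: "('x \<Rightarrow> real) \<Rightarrow> ('x \<Rightarrow> real) \<Rightarrow> real" where
  "weighted_norm \<rho> f = (SUP x. inverse (\<rho> x) * \<bar>f x\<bar>)"

definition weighted_bounded :: "('x \<Rightarrow> real) \<Rightarrow> ('x \<Rightarrow> real) set" where
  "weighted_bounded \<rho> = {f. bdd_above (range (\<lambda>x. inverse (\<rho> x) * \<bar>f x\<bar>))}"

text \<open>The closure of the bounded continuous functions for the weighted norm.\<close>

definition weighted_closure :: "'x topology \<Rightarrow> ('x \<Rightarrow> real) \<Rightarrow> ('x \<Rightarrow> real) set" where
  "weighted_closure X \<rho> =
     {f \<in> weighted_bounded \<rho>.
        \<forall>\<epsilon>>0. \<exists>g\<in>bounded_continuous X. weighted_norm \<rho> (\<lambda>x. f x - g x) < \<epsilon>}"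


section \<open>Generalised Feller semigroups\<close>

definition bounded_operator :: "'x topology \<Rightarrow> ('x \<Rightarrow> real) \<Rightarrow> (('x \<Rightarrow> real) \<Rightarrow> 'x \<Rightarrow> real) \<Rightarrow> bool" where
  "bounded_operator X \<rho> T \<longleftrightarrow>
     (\<forall>f\<in>weighted_closure X \<rho>. T f \<in> weighted_closure X \<rho>) \<and>
     (\<forall>f\<in>weighted_closure X \<rho>. \<forall>g\<in>weighted_closure X \<rho>. T (\<lambda>x. f x + g x) = (\<lambda>x. T f x + T g x)) \<and>
     (\<forall>f\<in>weighted_closure X \<rho>. \<forall>c. T (\<lambda>x. c * f x) = (\<lambda>x. c * T f x)) \<and>
     (\<exists>K. \<forall>f\<in>weighted_closure X \<rho>. weighted_norm \<rho> (T f) \<le> K * weighted_norm \<rho> f)"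

definition operator_norm :: "'x topology \<Rightarrow> ('x \<Rightarrow> real) \<Rightarrow> (('x \<Rightarrow> real) \<Rightarrow> 'x \<Rightarrow> real) \<Rightarrow> real" where
  "operator_norm X \<rho> T =
     (SUP f\<in>{f \<in> weighted_closure X \<rho>. weighted_norm \<rho> f \<le> 1}. weighted_norm \<rho> (T f))"

text \<open>Only the values \<open>P t f\<close> with \<open>t \<ge> 0\<close> and \<open>f \<in> weighted_closure X \<rho>\<close> are relevant.\<close>

definition generalised_feller_semigroup ::
  "'x topology \<Rightarrow> ('x \<Rightarrow> real) \<Rightarrow> (real \<Rightarrow> ('x \<Rightarrow> real) \<Rightarrow> 'x \<Rightarrow> real) \<Rightarrow> bool" where
  "generalised_feller_semigroup X \<rho> P \<longleftrightarrow>
     (\<forall>t\<ge>0. bounded_operator X \<rho> (P t)) \<and>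
     (\<forall>f\<in>weighted_closure X \<rho>. P 0 f = f) \<and>
     (\<forall>t\<ge>0. \<forall>s\<ge>0. \<forall>f\<in>weighted_closure X \<rho>. P (t + s) f = P t (P s f)) \<and>
     (\<forall>f\<in>weighted_closure X \<rho>. \<forall>x. ((\<lambda>t. P t f x) \<longlongrightarrow> f x) (at_right 0)) \<and>
     (\<exists>C>0. \<exists>\<epsilon>>0. \<forall>t\<in>{0..\<epsilon>}. operator_norm X \<rho> (P t) \<le> C) \<and>
     (\<forall>t\<ge>0. \<forall>f\<in>weighted_closure X \<rho>. (\<forall>x. 0 \<le> f x) \<longrightarrow> (\<forall>x. 0 \<le> P t f x))"


section \<open>Measures and processes\<close>

definition borel_algebra :: "'x topology \<Rightarrow> 'x measure" where
  "borel_algebra X = sigma (topspace X) {U. openin X U}"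

text \<open>
  \<open>adjoint_image X \<rho> T \<gamma> \<nu>\<close> says that \<open>\<nu>\<close> is the image of \<open>\<gamma>\<close> under the adjoint of \<open>T\<close>.
  As the functions in \<open>weighted_closure X \<rho>\<close> may be unbounded, their integrability is required
  for the pairings to make sense (the integral of a non-integrable function is 0 by convention).
\<close>

definition adjoint_image ::
  "'x topology \<Rightarrow> ('x \<Rightarrow> real) \<Rightarrow> (('x \<Rightarrow> real) \<Rightarrow> 'x \<Rightarrow> real) \<Rightarrow> 'x measure \<Rightarrow> 'x measure \<Rightarrow> bool" where
  "adjoint_image X \<rho> T \<gamma> \<nu> \<longleftrightarrow>
     (\<forall>\<phi>\<in>weighted_closure X \<rho>. integrable \<gamma> (T \<phi>) \<and> integrable \<nu> \<phi> \<and>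
        integral\<^sup>L \<gamma> (T \<phi>) = integral\<^sup>L \<nu> \<phi>)"

definition natural_filtration ::
  "'w measure \<Rightarrow> 'x topology \<Rightarrow> (real \<Rightarrow> 'w \<Rightarrow> 'x) \<Rightarrow> real \<Rightarrow> 'w measure" where
  "natural_filtration M X \<xi> s =
     sigma (space M) {\<xi> u -` A \<inter> space M | u A. 0 \<le> u \<and> u \<le> s \<and> A \<in> sets (borel_algebra X)}"

text \<open>
  A single process on a single probability space \<open>M\<close>, with an arbitrary initial law: the law of
  \<open>\<xi> t\<close> is the image under the adjoint of \<open>P t\<close> of the law of \<open>\<xi> 0\<close>, and \<open>\<xi>\<close> has the Markov
  property with transition operators \<open>P\<close> with respect to the filtration it generates.
\<close>

definition generalised_feller_process ::
  "'x topology \<Rightarrow> ('x \<Rightarrow> real) \<Rightarrow> (real \<Rightarrow> ('x \<Rightarrow> real) \<Rightarrow> 'x \<Rightarrow> real) \<Rightarrow>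
   'w measure \<Rightarrow> (real \<Rightarrow> 'w \<Rightarrow> 'x) \<Rightarrow> bool" where
  "generalised_feller_process X \<rho> P M \<xi> \<longleftrightarrow>
     generalised_feller_semigroup X \<rho> P \<and>
     prob_space M \<and>
     (\<forall>t\<ge>0. \<xi> t \<in> measurable M (borel_algebra X)) \<and>
     (\<forall>t\<ge>0. adjoint_image X \<rho> (P t)
        (distr M (borel_algebra X) (\<xi> 0)) (distr M (borel_algebra X) (\<xi> t))) \<and>
     (\<forall>s\<ge>0. \<forall>t\<ge>s. \<forall>\<phi>\<in>weighted_closure X \<rho>.
        AE \<omega> in M. real_cond_exp M (natural_filtration M X \<xi> s) (\<lambda>\<omega>. \<phi> (\<xi> t \<omega>)) \<omega>
                     = P (t - s) \<phi> (\<xi> s \<omega>))"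

definition invariant_measure ::
  "'x topology \<Rightarrow> ('x \<Rightarrow> real) \<Rightarrow> (real \<Rightarrow> ('x \<Rightarrow> real) \<Rightarrow> 'x \<Rightarrow> real) \<Rightarrow> 'x measure \<Rightarrow> bool" where
  "invariant_measure X \<rho> P \<mu> \<longleftrightarrow>
     prob_space \<mu> \<and> sets \<mu> = sets (borel_algebra X) \<and>
     (\<forall>\<phi>\<in>weighted_closure X \<rho>. integrable \<mu> \<phi>) \<and>
     (\<forall>t\<ge>0. \<forall>\<phi>\<in>weighted_closure X \<rho>. integral\<^sup>L \<mu> (P t \<phi>) = integral\<^sup>L \<mu> \<phi>)"


section \<open>The dual of a Banach space\<close>

text \<open>
  The dual of \<open>'y\<close> is \<open>'y \<Rightarrow>\<^sub>L real\<close>. For real-valued operators the strong operator topology is the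
  topology of pointwise convergence, i.e. the weak-star topology, and \<open>norm\<close> is the strong norm.
\<close>

abbreviation weak_star :: "('y::banach \<Rightarrow>\<^sub>L real) topology" where
  "weak_star \<equiv> strong_operator_topology"

definition dual_weight :: "('y::banach \<Rightarrow>\<^sub>L real) \<Rightarrow> real" where
  "dual_weight l = 1 + norm l"

lemma norm_dual_eq_SUP:
  fixes l :: "'y::banach \<Rightarrow>\<^sub>L real"
  shows "norm l = (SUP y\<in>{y. norm y \<le> 1}. blinfun_apply l y)"
proof -
  let ?S = "blinfun_apply l ` {y. norm y \<le> 1}"
  have ub: "blinfun_apply l y \<le> norm l" if "norm y \<le> 1" for y
  proof -
    have "blinfun_apply l y \<le> norm (blinfun_apply l y)" by simp
    also have "\<dots> \<le> norm l * norm y" by (rule norm_blinfun)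
    also have "\<dots> \<le> norm l" using that by (simp add: mult_left_le)
    finally show ?thesis .
  qed
  have bdd: "bdd_above ?S" using ub by (auto intro!: bdd_aboveI)
  have pos: "0 \<le> Sup ?S"
    using cSup_upper[OF _ bdd, of 0] by (force simp: image_iff blinfun.zero_right intro: exI[of _ 0])
  have "norm l \<le> Sup ?S"
  proof (rule norm_blinfun_bound[OF pos])
    fix y
    show "norm (blinfun_apply l y) \<le> Sup ?S * norm y"
    proof (cases "y = 0")
      case False
      define z where "z = (sgn (blinfun_apply l y) / norm y) *\<^sub>R y"
      have "norm z \<le> 1" using False by (simp add: z_def sgn_if)
      then have "blinfun_apply l z \<le> Sup ?S" by (intro cSup_upper[OF _ bdd]) auto
      moreover have "blinfun_apply l z = \<bar>blinfun_apply l y\<bar> / norm y"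
        by (simp add: z_def blinfun.scaleR_right sgn_if)
      ultimately show ?thesis using False by (simp add: field_simps)
    qed (simp add: blinfun.zero_right)
  qed
  moreover have "Sup ?S \<le> norm l"
    by (rule cSup_least) (use ub in \<open>auto intro: exI[of _ 0]\<close>)
  ultimately show ?thesis by linarith
qed

lemma admissible_dual_weight:
  "admissible_weight (weak_star :: ('y::banach \<Rightarrow>\<^sub>L real) topology) dual_weight"
proof -
  let ?W = "weak_star :: ('y \<Rightarrow>\<^sub>L real) topology"
  let ?P = "product_topology (\<lambda>_. euclideanreal) (UNIV :: 'y set)"
  let ?Z = "subtopology ?P (range blinfun_apply)"
  have P: "?P = euclidean" by (simp add: euclidean_product_topology)
  have inj: "inj (blinfun_apply :: ('y \<Rightarrow>\<^sub>L real) \<Rightarrow> _)"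
    by (auto intro!: injI blinfun_eqI)
  have top: "topspace ?W = UNIV" by (rule strong_operator_topology_topspace)
  have op: "openin ?W S \<longleftrightarrow> (\<exists>U. openin ?P U \<and> S = blinfun_apply -` U)" for S
    unfolding strong_operator_topology_def P by (simp add: openin_pullback_topology)
  have hom: "homeomorphic_map ?W ?Z blinfun_apply"
    unfolding homeomorphic_eq_everything_map
  proof (intro conjI)
    have "continuous_map ?W ?P blinfun_apply"
      unfolding continuous_map_def
    proof (intro conjI allI impI)
      fix U assume "openin ?P U"
      then show "openin ?W {x \<in> topspace ?W. blinfun_apply x \<in> U}"
        unfolding op top by (intro exI[of _ U]) auto
    qed simp
    then show "continuous_map ?W ?Z blinfun_apply"
      by (simp add: continuous_map_in_subtopology)
    show "open_map ?W ?Z blinfun_apply"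
      unfolding open_map_def
    proof (intro allI impI)
      fix S assume "openin ?W S"
      then obtain U where U: "openin ?P U" "S = blinfun_apply -` U" using op by blast
      then have "blinfun_apply ` S = U \<inter> range blinfun_apply" by auto
      then show "openin ?Z (blinfun_apply ` S)"
        unfolding openin_subtopology using U(1) by blast
    qed
    show "closed_map ?W ?Z blinfun_apply"
      unfolding closed_map_def
    proof (intro allI impI)
      fix C assume "closedin ?W C"
      then have "openin ?W (UNIV - C)" by (simp add: closedin_def top)
      then obtain U where U: "openin ?P U" "UNIV - C = blinfun_apply -` U"
        using op[of "UNIV - C"] by metis
      have C: "l \<in> C \<longleftrightarrow> blinfun_apply l \<notin> U" for l
        using U(2) by (metis Diff_iff UNIV_I vimage_eq)
      have "blinfun_apply ` C = (topspace ?P - U) \<inter> range blinfun_apply"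
        by (auto simp: C)
      moreover have "closedin ?P (topspace ?P - U)" using U(1) by blast
      ultimately show "closedin ?Z (blinfun_apply ` C)"
        unfolding closedin_subtopology by blast
    qed
  qed (use inj top in auto)
  then have homs: "?W homeomorphic_space ?Z"
    using homeomorphic_map_imp_homeomorphic_space by blast
  have "completely_regular_space ?P"
    unfolding completely_regular_space_product_topology
    using Met_TC.completely_regular_space_mtopology[where 'a = real] by simp
  then have cr: "completely_regular_space ?W"
    using homeomorphic_completely_regular_space[OF homs] completely_regular_space_subtopology by blast
  have "Hausdorff_space ?P" unfolding Hausdorff_space_product_topology by simp
  then have hd: "Hausdorff_space ?W"
    using homeomorphic_Hausdorff_space[OF homs] Hausdorff_space_subtopology by blast
  have "compactin ?W {l. dual_weight l \<le> R}" for R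
  proof -
    let ?r = "R - 1"
    let ?B = "{l :: 'y \<Rightarrow>\<^sub>L real. dual_weight l \<le> R}"
    let ?Q = "PiE UNIV (\<lambda>y. {- (?r * norm y)..?r * norm y})"
    let ?L = "{f. (\<forall>x y. f (x + y) = f x + f y) \<and> (\<forall>c x. f (c *\<^sub>R x) = c * f x)} :: ('y \<Rightarrow> real) set"
    have Q: "compactin ?P ?Q" by (simp add: compactin_PiE)
    have L: "closed ?L"
      by (intro closed_Collect_conj closed_Collect_all closed_Collect_eq continuous_intros
            continuous_on_product_coordinates)
    have img: "blinfun_apply ` ?B = ?Q \<inter> ?L" if "0 \<le> ?r"
    proof (intro equalityI subsetI)
      fix f assume "f \<in> blinfun_apply ` ?B"
      then obtain l where l: "f = blinfun_apply l" "norm l \<le> ?r" by (auto simp: dual_weight_def)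
      have "\<bar>blinfun_apply l y\<bar> \<le> ?r * norm y" for y
        using norm_blinfun[of l y] mult_right_mono[OF l(2), of "norm y"] by simp
      then show "f \<in> ?Q \<inter> ?L"
        by (auto simp: l(1) blinfun.add_right blinfun.scaleR_right abs_le_iff minus_le_iff)
    next
      fix f assume f: "f \<in> ?Q \<inter> ?L"
      then have b: "norm (f y) \<le> norm y * ?r" for y
        by (auto simp: PiE_iff abs_le_iff minus_le_iff mult.commute)
      have bl: "bounded_linear f"
        by (rule bounded_linear_intro[OF _ _ b]) (use f in auto)
      have "norm (Blinfun f) \<le> ?r"
        by (rule norm_blinfun_bound[OF that]) (use b bl in \<open>auto simp: bounded_linear_Blinfun_apply mult.commute\<close>)
      then show "f \<in> blinfun_apply ` ?B"
        using bl by (auto simp: dual_weight_def bounded_linear_Blinfun_apply intro!: image_eqI[of _ _ "Blinfun f"])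
    qed
    show ?thesis
    proof (cases "0 \<le> ?r")
      case True
      have "compactin ?P (?Q \<inter> ?L)"
        using closed_Int_compactin[OF _ Q, of ?L] L by (simp add: P Int_commute)
      then have "compactin ?Z (blinfun_apply ` ?B)"
        by (auto simp: img[OF True, symmetric] compactin_subtopology)
      then show ?thesis
        using homeomorphic_map_compactness[OF hom, of ?B] top by simp
    next
      case False
      then have "?B = {}" by (auto simp: dual_weight_def) (smt (verit) norm_ge_zero)
      then show ?thesis by simp
    qed
  qed
  then show ?thesis
    using top cr hd by (auto simp: admissible_weight_def dual_weight_def add_pos_nonneg)
qed

end

theory Submission
  imports Defs
begin

text \<open>
  The proof is a Krylov--Bogoliubov argument in which time averages are replaced by an invariant
  mean. Let \<open>m \<phi> t\<close> be the expectation of \<open>\<phi> (\<xi> t)\<close> for \<open>\<phi>\<close> in the weighted space. The moment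
  bound makes \<open>t \<mapsto> m \<phi> t\<close> bounded, and the semigroup law together with the adjoint relation gives
  \<open>m (P s \<phi>) t = m \<phi> (t + s)\<close>. Let \<open>L\<close> be a positive normalised linear functional on the bounded
  functions on \<open>[0, \<infinity>)\<close> that is invariant under all translations (\<open>invariant_mean_exists\<close>: the
  additive semigroup is commutative, hence amenable). Then \<open>\<Lambda> \<phi> = L (m \<phi>)\<close> satisfies
  \<open>\<Lambda> (P s \<phi>) = \<Lambda> \<phi>\<close>. Because \<open>L\<close> is defined on all bounded functions, no measurability in time is
  needed.

  It remains to see that \<open>\<Lambda>\<close> is integration against a measure. Since the weight has compact
  sublevel sets, the moment bound makes \<open>\<Lambda>\<close> tight on bounded continuous functions, and a positive,
  normalised, tight functional on a completely regular space is represented by a Borel probability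
  measure (\<open>integral_measure_rep\<close>). That measure integrates the weight (\<open>nn_integral_le\<close>, which is
  where the regularity of the constructed measure enters), so both \<open>\<Lambda>\<close> and the integral are
  continuous for the weighted norm; agreeing on bounded continuous functions, they agree on their
  closure. The argument works for every admissible weight
  (\<open>generalised_feller_process_invariant_measure\<close>), in particular for \<open>1 + norm\<close> on a dual space,
  whose sublevel sets are weak-star compact by Banach--Alaoglu.
\<close>


section \<open>Invariant means on commutative semigroups\<close>

text \<open>
  Means on the bounded real functions on \<open>S\<close>, encoded as functionals on all functions of the
  type. Functions that are unbounded on \<open>S\<close> are sent to 0, so that the means form a subset of a
  product of compact intervals.
\<close>

definition mean_on :: "'a set \<Rightarrow> (('a \<Rightarrow> real) \<Rightarrow> real) \<Rightarrow> bool" where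
  "mean_on S L \<longleftrightarrow>
     (\<forall>F G. bounded (F ` S) \<longrightarrow> bounded (G ` S) \<longrightarrow> L (\<lambda>t. F t + G t) = L F + L G) \<and>
     (\<forall>F c. bounded (F ` S) \<longrightarrow> L (\<lambda>t. c * F t) = c * L F) \<and>
     (\<forall>F. bounded (F ` S) \<longrightarrow> (\<forall>t\<in>S. 0 \<le> F t) \<longrightarrow> 0 \<le> L F) \<and>
     L (\<lambda>_. 1) = 1 \<and>
     (\<forall>F. \<not> bounded (F ` S) \<longrightarrow> L F = 0)"

lemma bounded_image_real_iff:
  fixes F :: "'a \<Rightarrow> real"
  shows "bounded (F ` S) \<longleftrightarrow> (\<exists>c. \<forall>t\<in>S. \<bar>F t\<bar> \<le> c)"
  by (auto simp: bounded_iff)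

lemma bounded_image_add:
  fixes F G :: "'a \<Rightarrow> real"
  assumes "bounded (F ` S)" "bounded (G ` S)"
  shows "bounded ((\<lambda>t. F t + G t) ` S)"
proof -
  obtain a b where "\<forall>t\<in>S. \<bar>F t\<bar> \<le> a" "\<forall>t\<in>S. \<bar>G t\<bar> \<le> b"
    using assms by (auto simp: bounded_image_real_iff)
  then have "\<forall>t\<in>S. \<bar>F t + G t\<bar> \<le> a + b" by fastforce
  then show ?thesis by (auto simp: bounded_image_real_iff)
qed

lemma bounded_image_cmult:
  fixes F :: "'a \<Rightarrow> real"
  assumes "bounded (F ` S)"
  shows "bounded ((\<lambda>t. c * F t) ` S)"
proof -
  obtain a where "\<forall>t\<in>S. \<bar>F t\<bar> \<le> a"
    using assms by (auto simp: bounded_image_real_iff)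
  then have "\<forall>t\<in>S. \<bar>c * F t\<bar> \<le> \<bar>c\<bar> * a" by (auto simp: abs_mult intro: mult_left_mono)
  then show ?thesis by (auto simp: bounded_image_real_iff)
qed

lemma mean_on_mono:
  assumes L: "mean_on S L" and bd: "bounded (F ` S)" "bounded (G ` S)"
    and le: "\<And>t. t \<in> S \<Longrightarrow> F t \<le> G t"
  shows "L F \<le> L G"
proof -
  have bd': "bounded ((\<lambda>t. (-1) * F t) ` S)" by (rule bounded_image_cmult[OF bd(1)])
  have "0 \<le> L (\<lambda>t. G t + (-1) * F t)"
    using L le bounded_image_add[OF bd(2) bd'] unfolding mean_on_def by auto
  also have "\<dots> = L G + L (\<lambda>t. (-1) * F t)"
    using L bd(2) bd' unfolding mean_on_def by blast
  also have "L (\<lambda>t. (-1) * F t) = (-1) * L F"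
    using L bd(1) unfolding mean_on_def by blast
  finally show ?thesis by simp
qed

lemma mean_on_const:
  assumes L: "mean_on S L"
  shows "L (\<lambda>_. c) = c"
proof -
  have bd: "bounded ((\<lambda>_. 1::real) ` S)" by (auto simp: bounded_image_real_iff)
  have "L (\<lambda>_. c * 1) = c * L (\<lambda>_. 1)"
    using L bd unfolding mean_on_def by blast
  then show ?thesis using L by (simp add: mean_on_def)
qed

lemma mean_on_abs_le:
  assumes L: "mean_on S L" and le: "\<And>t. t \<in> S \<Longrightarrow> \<bar>F t\<bar> \<le> c"
  shows "\<bar>L F\<bar> \<le> c"
proof -
  have bd: "bounded (F ` S)" and bc: "bounded ((\<lambda>_. d) ` S)" for d :: real
    using le by (auto simp: bounded_image_real_iff)
  have "L F \<le> L (\<lambda>_. c)" "L (\<lambda>_. - c) \<le> L F"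
    using le by (auto intro!: mean_on_mono[OF L] bd bc simp: abs_le_iff minus_le_iff)
  then show ?thesis by (auto simp: mean_on_const[OF L])
qed

lemma mean_on_diff_abs_le:
  assumes L: "mean_on S L" and bd: "bounded (F ` S)" "bounded (G ` S)"
    and le: "\<And>t. t \<in> S \<Longrightarrow> \<bar>F t - G t\<bar> \<le> c"
  shows "\<bar>L F - L G\<bar> \<le> c"
proof -
  have bd': "bounded ((\<lambda>t. (-1) * G t) ` S)" by (rule bounded_image_cmult[OF bd(2)])
  have "L (\<lambda>t. F t + (-1) * G t) = L F + L (\<lambda>t. (-1) * G t)"
    using L bd(1) bd' unfolding mean_on_def by blast
  also have "L (\<lambda>t. (-1) * G t) = (-1) * L G"
    using L bd(2) unfolding mean_on_def by blast
  finally show ?thesis using mean_on_abs_le[OF L, of "\<lambda>t. F t + (-1) * G t" c] le by simp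
qed

text \<open>
  The average of \<open>F\<close> over \<open>t, t + s, \<dots>, t + (n - 1) s\<close>; the \<open>i\<close>-fold multiple of \<open>s\<close> is written as an
  iterate of addition.
\<close>

definition cesaro :: "'a::comm_monoid_add \<Rightarrow> nat \<Rightarrow> ('a \<Rightarrow> real) \<Rightarrow> 'a \<Rightarrow> real" where
  "cesaro s n F t = (\<Sum>i<n. F (t + ((+) s ^^ i) 0)) / n"

lemma multiple_in_submonoid:
  fixes S :: "'a::comm_monoid_add set"
  assumes "0 \<in> S" "\<And>a b. a \<in> S \<Longrightarrow> b \<in> S \<Longrightarrow> a + b \<in> S" "s \<in> S"
  shows "((+) s ^^ i) 0 \<in> S"
  by (induction i) (use assms in auto)

lemma cesaro_abs_le:
  fixes S :: "'a::comm_monoid_add set"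
  assumes S: "0 \<in> S" "\<And>a b. a \<in> S \<Longrightarrow> b \<in> S \<Longrightarrow> a + b \<in> S" "s \<in> S" and n: "0 < n"
    and F: "\<And>t. t \<in> S \<Longrightarrow> \<bar>F t\<bar> \<le> c" and t: "t \<in> S"
  shows "\<bar>cesaro s n F t\<bar> \<le> c"
proof -
  have "\<bar>\<Sum>i<n. F (t + ((+) s ^^ i) 0)\<bar> \<le> (\<Sum>i<n. \<bar>F (t + ((+) s ^^ i) 0)\<bar>)" by (rule sum_abs)
  also have "\<dots> \<le> (\<Sum>i<n. c)"
    using S t by (intro sum_mono F S(2) multiple_in_submonoid) auto
  finally show ?thesis using n by (simp add: cesaro_def abs_div divide_le_eq mult.commute)
qed

lemma cesaro_shift_diff:
  fixes S :: "'a::comm_monoid_add set"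
  assumes S: "0 \<in> S" "\<And>a b. a \<in> S \<Longrightarrow> b \<in> S \<Longrightarrow> a + b \<in> S" "s \<in> S" and n: "0 < n"
    and F: "\<And>t. t \<in> S \<Longrightarrow> \<bar>F t\<bar> \<le> c" and t: "t \<in> S"
  shows "\<bar>cesaro s n (\<lambda>t. F (t + s)) t - cesaro s n F t\<bar> \<le> 2 * c / n"
proof -
  let ?G = "\<lambda>i. F (t + ((+) s ^^ i) 0)"
  have "(\<Sum>i<n. F (t + ((+) s ^^ i) 0 + s)) - (\<Sum>i<n. ?G i) = (\<Sum>i<n. ?G (Suc i) - ?G i)"
    by (simp add: sum_subtractf add.commute add.left_commute)
  also have "\<dots> = ?G n - ?G 0" by (rule sum_lessThan_telescope)
  finally have "\<bar>(\<Sum>i<n. F (t + ((+) s ^^ i) 0 + s)) - (\<Sum>i<n. ?G i)\<bar> \<le> 2 * c"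
    using F[of "t + ((+) s ^^ n) 0"] F[of t] t S(2) multiple_in_submonoid[OF S, of n] by fastforce
  then show ?thesis using n by (simp add: cesaro_def diff_divide_distrib[symmetric] divide_right_mono)
qed

lemma mean_on_cesaro:
  fixes S :: "'a::comm_monoid_add set"
  assumes S: "0 \<in> S" "\<And>a b. a \<in> S \<Longrightarrow> b \<in> S \<Longrightarrow> a + b \<in> S" "s \<in> S" and n: "0 < n"
    and L: "mean_on S L"
  shows "mean_on S (\<lambda>F. if bounded (F ` S) then L (cesaro s n F) else 0)"
proof -
  have bd: "bounded (cesaro s n F ` S)" if F: "bounded (F ` S)" for F
    using F cesaro_abs_le[OF S n, of F] unfolding bounded_image_real_iff by metis
  have add: "cesaro s n (\<lambda>t. F t + G t) = (\<lambda>t. cesaro s n F t + cesaro s n G t)" for F G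
    by (auto simp: cesaro_def sum.distrib add_divide_distrib)
  have cm: "cesaro s n (\<lambda>t. a * F t) = (\<lambda>t. a * cesaro s n F t)" for F a
    by (auto simp: cesaro_def sum_distrib_left)
  have one: "cesaro s n (\<lambda>_. 1) = (\<lambda>_. 1)" using n by (auto simp: cesaro_def)
  have pos: "0 \<le> cesaro s n F t" if "\<forall>t\<in>S. 0 \<le> F t" "t \<in> S" for F t
    using that S multiple_in_submonoid[OF S] by (auto simp: cesaro_def intro!: sum_nonneg divide_nonneg_nonneg)
  have b1: "bounded ((\<lambda>_. 1::real) ` S)" by (auto simp: bounded_image_real_iff)
  show ?thesis
    using L bd pos b1 unfolding mean_on_def
    by (simp add: add cm one bounded_image_add bounded_image_cmult)
qed

text \<open>
  The means form a compact set for pointwise convergence, and each approximate invariance condition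
  \<open>E (s, n)\<close> below is closed. Composing a mean with a Cesaro average over multiples of \<open>s\<close> makes it
  satisfy \<open>E (s, n)\<close> and, since averages commute with translations, preserves all the conditions it
  already satisfied. So finitely many conditions can always be met, and by compactness all of
  them.
\<close>

theorem invariant_mean_exists:
  fixes S :: "'a::comm_monoid_add set"
  assumes S: "0 \<in> S" "\<And>a b. a \<in> S \<Longrightarrow> b \<in> S \<Longrightarrow> a + b \<in> S"
  obtains L where "mean_on S L"
    "\<And>s F. s \<in> S \<Longrightarrow> bounded (F ` S) \<Longrightarrow> L (\<lambda>t. F (t + s)) = L F"
proof -
  define N where "N F = (if bounded (F ` S) then SOME c. \<forall>t\<in>S. \<bar>F t\<bar> \<le> c else 0)" for F :: "'a \<Rightarrow> real"
  have N: "\<bar>F t\<bar> \<le> N F" if "bounded (F ` S)" "t \<in> S" for F t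
  proof -
    have "\<exists>c. \<forall>t\<in>S. \<bar>F t\<bar> \<le> c" using that(1) by (simp add: bounded_image_real_iff)
    from someI_ex[OF this] show ?thesis using that by (simp add: N_def)
  qed
  define Q where "Q = PiE UNIV (\<lambda>F::'a \<Rightarrow> real. {- N F..N F})"
  have Q: "compact Q"
    unfolding Q_def
    using compactin_PiE[of "\<lambda>_. euclideanreal" UNIV "\<lambda>F::'a \<Rightarrow> real. {- N F..N F}"]
    by (simp add: euclidean_product_topology)
  have mQ: "L \<in> Q" if "mean_on S L" for L
  proof -
    have "\<bar>L F\<bar> \<le> N F" for F
    proof (cases "bounded (F ` S)")
      case True then show ?thesis using mean_on_abs_le[OF that] N by blast
    next
      case False then show ?thesis using that by (simp add: mean_on_def N_def)
    qed
    then show ?thesis by (auto simp: Q_def abs_le_iff minus_le_iff)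
  qed
  define K where "K = {L. mean_on S L}"
  have "closed K"
    unfolding K_def mean_on_def
    by (intro closed_Collect_conj closed_Collect_all closed_Collect_eq closed_Collect_le
          closed_Collect_imp open_Collect_const continuous_intros continuous_on_product_coordinates)
  moreover have "K = Q \<inter> K" using mQ by (auto simp: K_def)
  ultimately have K: "compact K" using compact_Int_closed[OF Q] by metis
  define E where "E = (\<lambda>(s, n::nat). {L :: ('a \<Rightarrow> real) \<Rightarrow> real.
     \<forall>F c. (\<forall>t\<in>S. \<bar>F t\<bar> \<le> c) \<longrightarrow> \<bar>L (\<lambda>t. F (t + s)) - L F\<bar> \<le> 2 * c / n})"
  have E: "closed (E p)" for p
    unfolding E_def case_prod_beta
    by (intro closed_Collect_conj closed_Collect_all closed_Collect_le
          closed_Collect_imp open_Collect_const continuous_intros continuous_on_product_coordinates)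
  have fip: "K \<inter> (\<Inter>p\<in>T. E p) \<noteq> {}" if "finite T" "T \<subseteq> S \<times> {0<..}" for T
    using that
  proof (induction T)
    case empty
    \<comment> \<open>Evaluation at 0 is a mean.\<close>
    have "mean_on S (\<lambda>F. if bounded (F ` S) then F 0 else 0)"
      unfolding mean_on_def using S(1)
      by (auto simp: bounded_image_add bounded_image_cmult) (auto simp: bounded_image_real_iff)
    then show ?case by (auto simp: K_def)
  next
    case (insert p T)
    obtain s n where p: "p = (s, n)" "s \<in> S" "0 < n" using insert.prems by auto
    obtain L where L: "mean_on S L" "\<And>p. p \<in> T \<Longrightarrow> L \<in> E p"
      using insert by (auto simp: K_def)
    define L' where "L' = (\<lambda>F. if bounded (F ` S) then L (cesaro s n F) else 0)"
    have 1: "mean_on S L'" unfolding L'_def by (rule mean_on_cesaro[OF S p(2,3) L(1)])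
    have L': "L' F = L (cesaro s n F)" if "\<forall>t\<in>S. \<bar>F t\<bar> \<le> c" for F c
      using that by (auto simp: L'_def bounded_image_real_iff)
    have bd: "bounded (cesaro s n F ` S)" if F: "\<forall>t\<in>S. \<bar>F t\<bar> \<le> c" for F c
      using F cesaro_abs_le[OF S p(2,3), of F] unfolding bounded_image_real_iff by metis
    have 2: "L' \<in> E (s, n)"
      unfolding E_def
    proof (clarsimp)
      fix F :: "'a \<Rightarrow> real" and c assume F: "\<forall>t\<in>S. \<bar>F t\<bar> \<le> c"
      then have F': "\<forall>t\<in>S. \<bar>F (t + s)\<bar> \<le> c" using S(2) p(2) by auto
      show "\<bar>L' (\<lambda>t. F (t + s)) - L' F\<bar> \<le> 2 * c / n"
        unfolding L'[OF F] L'[OF F']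
        by (intro mean_on_diff_abs_le[OF L(1)] bd[OF F] bd[OF F'] cesaro_shift_diff[OF S p(2,3)]) (use F in auto)
    qed
    have 3: "L' \<in> E q" if q: "q \<in> T" for q
    proof -
      obtain r m where r: "q = (r, m)" "r \<in> S" using q insert.prems by auto
      show ?thesis
        unfolding E_def r
      proof (clarsimp)
        fix F :: "'a \<Rightarrow> real" and c assume F: "\<forall>t\<in>S. \<bar>F t\<bar> \<le> c"
        then have F': "\<forall>t\<in>S. \<bar>F (t + r)\<bar> \<le> c" using S(2) r(2) by auto
        have "cesaro s n (\<lambda>t. F (t + r)) = (\<lambda>t. cesaro s n F (t + r))"
          by (auto simp: cesaro_def ac_simps)
        then show "\<bar>L' (\<lambda>t. F (t + r)) - L' F\<bar> \<le> 2 * c / m"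
          unfolding L'[OF F] L'[OF F']
          using L(2)[OF q] cesaro_abs_le[OF S p(2,3), of F c] F by (auto simp: r E_def)
      qed
    qed
    show ?case using 1 2 3 by (auto simp: K_def p)
  qed
  have "K \<inter> (\<Inter>p\<in>S \<times> {0<..}. E p) \<noteq> {}"
    by (rule compact_imp_fip_image[OF K]) (use E fip in auto)
  then obtain L where L: "mean_on S L" "\<And>s n. s \<in> S \<Longrightarrow> 0 < n \<Longrightarrow> L \<in> E (s, n)"
    by (auto simp: K_def)
  show ?thesis
  proof (rule that[OF L(1)])
    fix s and F :: "'a \<Rightarrow> real" assume s: "s \<in> S" and F: "bounded (F ` S)"
    have le: "\<bar>L (\<lambda>t. F (t + s)) - L F\<bar> \<le> 2 * N F / Suc n" for n
      using L(2)[OF s, of "Suc n"] N[OF F] by (auto simp: E_def)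
    have "(\<lambda>n. 2 * N F / Suc n) \<longlonglongrightarrow> 0"
      using LIMSEQ_Suc[OF lim_const_over_n[of "2 * N F"]] by simp
    from LIMSEQ_le_const[OF this] le have "\<bar>L (\<lambda>t. F (t + s)) - L F\<bar> \<le> 0" by blast
    then show "L (\<lambda>t. F (t + s)) = L F" by simp
  qed
qed


section \<open>Bounded continuous functions\<close>

lemma bounded_continuous_iff:
  "f \<in> bounded_continuous X \<longleftrightarrow> continuous_map X euclideanreal f \<and> (\<exists>c. \<forall>x. \<bar>f x\<bar> \<le> c)"
  by (auto simp: bounded_continuous_def bounded_iff)

lemma bounded_continuous_const: "(\<lambda>_. c) \<in> bounded_continuous X"
  by (auto simp: bounded_continuous_iff)

lemma bounded_continuous_add:
  assumes "f \<in> bounded_continuous X" "g \<in> bounded_continuous X"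
  shows "(\<lambda>x. f x + g x) \<in> bounded_continuous X"
proof -
  obtain a b where "\<And>x. \<bar>f x\<bar> \<le> a" "\<And>x. \<bar>g x\<bar> \<le> b"
    using assms by (auto simp: bounded_continuous_iff)
  then have "\<bar>f x + g x\<bar> \<le> a + b" for x by (meson abs_triangle_ineq add_mono order_trans)
  then show ?thesis using assms by (auto simp: bounded_continuous_iff intro!: continuous_intros)
qed

lemma bounded_continuous_cmult:
  assumes "f \<in> bounded_continuous X"
  shows "(\<lambda>x. c * f x) \<in> bounded_continuous X"
proof -
  obtain a where "\<And>x. \<bar>f x\<bar> \<le> a"
    using assms by (auto simp: bounded_continuous_iff)
  then have "\<bar>c * f x\<bar> \<le> \<bar>c\<bar> * a" for x by (simp add: abs_mult mult_left_mono)
  then show ?thesis using assms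
    by (auto simp: bounded_continuous_iff intro!: continuous_map_real_mult_left)
qed

lemma bounded_continuous_diff:
  assumes "f \<in> bounded_continuous X" "g \<in> bounded_continuous X"
  shows "(\<lambda>x. f x - g x) \<in> bounded_continuous X"
  using bounded_continuous_add[OF assms(1) bounded_continuous_cmult[OF assms(2), of "-1"]] by simp

lemma bounded_continuous_sum:
  assumes "\<And>i. i \<in> I \<Longrightarrow> f i \<in> bounded_continuous X"
  shows "(\<lambda>x. \<Sum>i\<in>I. f i x) \<in> bounded_continuous X"
  using assms
  by (induction I rule: infinite_finite_induct) (auto simp: bounded_continuous_const bounded_continuous_add)

lemma bounded_continuous_max:
  assumes "f \<in> bounded_continuous X"
  shows "(\<lambda>x. max c (f x)) \<in> bounded_continuous X"
proof -
  obtain a where a: "\<And>x. \<bar>f x\<bar> \<le> a" using assms by (auto simp: bounded_continuous_iff)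
  have "\<bar>max c (f x)\<bar> \<le> max \<bar>c\<bar> a" for x using a[of x] by linarith
  then show ?thesis using assms by (auto simp: bounded_continuous_iff intro!: continuous_intros)
qed

lemma bounded_continuous_min:
  assumes "f \<in> bounded_continuous X"
  shows "(\<lambda>x. min c (f x)) \<in> bounded_continuous X"
proof -
  obtain a where a: "\<And>x. \<bar>f x\<bar> \<le> a" using assms by (auto simp: bounded_continuous_iff)
  have "\<bar>min c (f x)\<bar> \<le> max \<bar>c\<bar> a" for x using a[of x] by linarith
  then show ?thesis using assms by (auto simp: bounded_continuous_iff intro!: continuous_intros)
qed

lemma space_borel_algebra: "space (borel_algebra X) = topspace X"
  and sets_borel_algebra: "sets (borel_algebra X) = sigma_sets (topspace X) {U. openin X U}"
  by (auto simp: borel_algebra_def space_measure_of_conv intro!: sets_measure_of dest: openin_subset)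

lemma continuous_map_borel_measurable:
  assumes f: "continuous_map X euclideanreal f"
  shows "f \<in> borel_measurable (borel_algebra X)"
proof (rule borel_measurableI)
  fix S :: "real set" assume "open S"
  then have "openin X {x \<in> topspace X. f x \<in> S}"
    using f by (auto simp: continuous_map_def)
  moreover have "f -` S \<inter> space (borel_algebra X) = {x \<in> topspace X. f x \<in> S}"
    by (auto simp: space_borel_algebra)
  ultimately show "f -` S \<inter> space (borel_algebra X) \<in> sets (borel_algebra X)"
    by (simp add: sets_borel_algebra sigma_sets.Basic)
qed

lemma ennreal_le_add_SUP_witness:
  fixes f :: "'a \<Rightarrow> ennreal"
  assumes "(SUP i\<in>A. f i) \<noteq> \<infinity>" "A \<noteq> {}" "0 < e"
  obtains i where "i \<in> A" "(SUP i\<in>A. f i) \<le> f i + ennreal e"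
  using SUP_approx_ennreal[OF _ assms(2) refl assms(1), of e] assms(3) by (auto intro: less_imp_le)

lemma continuous_map_openin_less:
  assumes "continuous_map X euclideanreal f"
  shows "openin X {x \<in> topspace X. c < f x}" "openin X {x \<in> topspace X. f x < c}"
proof -
  have "openin X {x \<in> topspace X. f x \<in> {c<..}}" "openin X {x \<in> topspace X. f x \<in> {..<c}}"
    using assms by (rule openin_continuous_map_preimage, simp)+
  then show "openin X {x \<in> topspace X. c < f x}" "openin X {x \<in> topspace X. f x < c}" by auto
qed


section \<open>Riesz representation of tight positive functionals\<close>

text \<open>
  A positive normalised linear functional on the bounded continuous functions that is small,
  uniformly, on functions between 0 and 1 vanishing on a large compact set.
\<close>

locale tight_functional =
  fixes X :: "'x topology" and \<Lambda> :: "('x \<Rightarrow> real) \<Rightarrow> real"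
  assumes topspace_UNIV: "topspace X = UNIV"
    and completely_regular: "completely_regular_space X"
    and add: "\<And>f g. f \<in> bounded_continuous X \<Longrightarrow> g \<in> bounded_continuous X \<Longrightarrow>
               \<Lambda> (\<lambda>x. f x + g x) = \<Lambda> f + \<Lambda> g"
    and cmult: "\<And>f c. f \<in> bounded_continuous X \<Longrightarrow> \<Lambda> (\<lambda>x. c * f x) = c * \<Lambda> f"
    and nonneg: "\<And>f. f \<in> bounded_continuous X \<Longrightarrow> (\<And>x. 0 \<le> f x) \<Longrightarrow> 0 \<le> \<Lambda> f"
    and one: "\<Lambda> (\<lambda>_. 1) = 1"
    and tight: "\<And>\<epsilon>. 0 < \<epsilon> \<Longrightarrow> \<exists>K. compactin X K \<and>
               (\<forall>f\<in>bounded_continuous X. (\<forall>x. 0 \<le> f x \<and> f x \<le> 1) \<longrightarrow> (\<forall>x\<in>K. f x = 0) \<longrightarrow> \<Lambda> f \<le> \<epsilon>)"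
begin

lemma const: "\<Lambda> (\<lambda>_. c) = c"
  using cmult[OF bounded_continuous_const, of c 1] one by simp

lemma diff:
  assumes "f \<in> bounded_continuous X" "g \<in> bounded_continuous X"
  shows "\<Lambda> (\<lambda>x. f x - g x) = \<Lambda> f - \<Lambda> g"
  using add[OF assms(1) bounded_continuous_cmult[OF assms(2), of "-1"]] cmult[OF assms(2), of "-1"] by simp

lemma mono:
  assumes "f \<in> bounded_continuous X" "g \<in> bounded_continuous X" "\<And>x. f x \<le> g x"
  shows "\<Lambda> f \<le> \<Lambda> g"
  using nonneg[OF bounded_continuous_diff[OF assms(2,1)]] assms diff[OF assms(2,1)] by simp

lemma sum:
  assumes "\<And>i. i \<in> I \<Longrightarrow> f i \<in> bounded_continuous X"
  shows "\<Lambda> (\<lambda>x. \<Sum>i\<in>I. f i x) = (\<Sum>i\<in>I. \<Lambda> (f i))"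
  using assms
  by (induction I rule: infinite_finite_induct) (auto simp: const add bounded_continuous_sum)

text \<open>The continuous functions between 0 and the indicator of \<open>U\<close>.\<close>

definition below :: "'x set \<Rightarrow> ('x \<Rightarrow> real) set" where
  "below U = {f \<in> bounded_continuous X. \<forall>x. 0 \<le> f x \<and> f x \<le> indicat_real U x}"

lemma belowI:
  assumes "f \<in> bounded_continuous X" "\<And>x. 0 \<le> f x" "\<And>x. f x \<le> 1" "\<And>x. x \<notin> U \<Longrightarrow> f x = 0"
  shows "f \<in> below U"
  using assms by (auto simp: below_def indicator_def)

lemma belowD:
  assumes "f \<in> below U"
  shows "f \<in> bounded_continuous X" "\<And>x. 0 \<le> f x" "\<And>x. f x \<le> 1" "\<And>x. x \<notin> U \<Longrightarrow> f x = 0"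
proof -
  have b: "0 \<le> f x \<and> f x \<le> indicat_real U x" for x using assms by (simp add: below_def)
  show "f \<in> bounded_continuous X" using assms by (simp add: below_def)
  show "0 \<le> f x" "f x \<le> 1" for x using b[of x] by (cases "x \<in> U"; simp)+
  show "f x = 0" if "x \<notin> U" for x using b[of x] that by simp
qed

lemma zero_below: "(\<lambda>_. 0) \<in> below U"
  by (auto intro!: belowI bounded_continuous_const)

lemma \<Lambda>_below: assumes "f \<in> below U" shows "0 \<le> \<Lambda> f" "\<Lambda> f \<le> 1"
  using mono[OF belowD(1)[OF assms] bounded_continuous_const, of 1] nonneg[of f] belowD[OF assms] const
  by auto

text \<open>
  The candidate value of the representing measure on an open set, and the outer measure that it
  induces. Only open \<open>U\<close> are meant as arguments of \<open>mass\<close>.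
\<close>

definition mass :: "'x set \<Rightarrow> ennreal" where
  "mass U = (SUP f\<in>below U. ennreal (\<Lambda> f))"

definition outer :: "'x set \<Rightarrow> ennreal" where
  "outer A = (INF U\<in>{U. openin X U \<and> A \<subseteq> U}. mass U)"

lemma mass_ge: "f \<in> below U \<Longrightarrow> ennreal (\<Lambda> f) \<le> mass U"
  unfolding mass_def by (rule SUP_upper)

lemma mass_le_1: "mass U \<le> 1"
  unfolding mass_def by (rule SUP_least) (use \<Lambda>_below in \<open>auto simp: ennreal_le_1\<close>)

lemma mass_finite: "mass U \<noteq> \<infinity>"
  using mass_le_1[of U] by (auto simp: top_unique)

lemma mass_mono: "U \<subseteq> V \<Longrightarrow> mass U \<le> mass V"
  unfolding mass_def
  by (rule SUP_subset_mono) (auto intro!: belowI dest: belowD)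

lemma mass_approx:
  assumes "0 < e"
  obtains f where "f \<in> below U" "mass U \<le> ennreal (\<Lambda> f + e)"
proof -
  obtain f where "f \<in> below U" "mass U \<le> ennreal (\<Lambda> f) + ennreal e"
    using ennreal_le_add_SUP_witness[of "\<lambda>f. ennreal (\<Lambda> f)" "below U" e] mass_finite[of U] assms zero_below
    unfolding mass_def by blast
  then show ?thesis using assms \<Lambda>_below that by (simp add: ennreal_plus)
qed

text \<open>
  This is the only place where tightness and complete regularity are used. If \<open>f\<close> is below the
  union, then the part of a large compact set where \<open>f \<ge> e\<close> is covered by finitely many of the sets
  \<open>U n\<close>, and complete regularity yields functions \<open>G j\<close> below \<open>U j\<close> whose sum is at least 1 there.
  Hence \<open>f\<close> exceeds that sum by at most \<open>e\<close>, up to a function \<open>u\<close> vanishing on the compact set.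
\<close>

lemma mass_countably_subadditive:
  assumes U: "\<And>n::nat. openin X (U n)"
  shows "mass (\<Union>n. U n) \<le> (\<Sum>n. mass (U n))"
  unfolding mass_def[of "\<Union>n. U n"]
proof (rule SUP_least, rule ennreal_le_epsilon)
  fix f and d :: real assume f: "f \<in> below (\<Union>n. U n)" and d: "0 < d"
  define e where "e = d / 2"
  have e: "0 < e" using d by (simp add: e_def)
  note f' = belowD[OF f]
  obtain K where K: "compactin X K"
    "\<And>f. f \<in> bounded_continuous X \<Longrightarrow> (\<And>x. 0 \<le> f x \<and> f x \<le> 1) \<Longrightarrow> (\<And>x. x \<in> K \<Longrightarrow> f x = 0) \<Longrightarrow> \<Lambda> f \<le> e"
    using tight[OF e] by blast
  define C where "C = {x. e \<le> f x} \<inter> K"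
  have "closedin X (UNIV - {x. f x < e})"
    using continuous_map_openin_less(2)[of X f e] f'(1) closedin_topspace[of X] topspace_UNIV
    by (auto simp: bounded_continuous_iff intro: closedin_diff)
  moreover have "UNIV - {x. f x < e} = {x. e \<le> f x}" by auto
  ultimately have C: "compactin X C" unfolding C_def using K(1) closed_Int_compactin by metis
  have "\<exists>n g. continuous_map X (top_of_set {0..1::real}) g \<and> g x = 1 \<and> (\<forall>y. y \<notin> U n \<longrightarrow> g y = 0)"
    if "x \<in> C" for x
  proof -
    have "x \<in> (\<Union>n. U n)" using that f'(4)[of x] e by (force simp: C_def)
    then obtain n where n: "x \<in> U n" by auto
    then have "x \<in> topspace X - (topspace X - U n)" by (simp add: topspace_UNIV)
    moreover have "closedin X (topspace X - U n)" by (intro closedin_diff closedin_topspace U)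
    ultimately obtain g where g: "continuous_map X (top_of_set {0..1::real}) g" "g x = 0"
       "g ` (topspace X - U n) \<subseteq> {1}"
      using completely_regular unfolding completely_regular_space_def by blast
    have "continuous_map X (top_of_set {0..1::real}) (\<lambda>x. 1 - g x)"
      using g(1) by (auto simp: continuous_map_in_subtopology intro!: continuous_intros)
    then show ?thesis using g by (intro exI[of _ n] exI[of _ "\<lambda>x. 1 - g x"]) (auto simp: topspace_UNIV)
  qed
  then obtain N g where g: "\<And>x. x \<in> C \<Longrightarrow> continuous_map X (top_of_set {0..1::real}) (g x)"
     "\<And>x. x \<in> C \<Longrightarrow> g x x = 1" "\<And>x y. x \<in> C \<Longrightarrow> y \<notin> U (N x) \<Longrightarrow> g x y = 0" by metis
  have g01: "0 \<le> g x y \<and> g x y \<le> 1" if "x \<in> C" for x y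
    using continuous_map_image_subset_topspace[OF g(1)[OF that]]
    by (auto simp: topspace_UNIV image_subset_iff)
  have gc: "g x \<in> bounded_continuous X" if "x \<in> C" for x
    using g(1)[OF that] g01[OF that]
    by (auto simp: bounded_continuous_iff continuous_map_in_subtopology intro!: exI[of _ 1])
  have "\<exists>\<F>. finite \<F> \<and> \<F> \<subseteq> (\<lambda>x. {y \<in> topspace X. 1/2 < g x y}) ` C \<and> C \<subseteq> \<Union>\<F>"
  proof (rule compactinD[OF C])
    show "C \<subseteq> \<Union>((\<lambda>x. {y \<in> topspace X. 1/2 < g x y}) ` C)"
      using g(2) by (auto simp: topspace_UNIV)
    show "openin X W" if W: "W \<in> (\<lambda>x. {y \<in> topspace X. 1/2 < g x y}) ` C" for W
    proof -
      obtain x where x: "x \<in> C" "W = {y \<in> topspace X. 1/2 < g x y}" using W by blast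
      have "continuous_map X euclideanreal (g x)" using gc[OF x(1)] by (simp add: bounded_continuous_iff)
      then show ?thesis unfolding x(2) by (rule continuous_map_openin_less(1))
    qed
  qed
  then obtain \<F> where \<F>: "finite \<F>" "\<F> \<subseteq> (\<lambda>x. {y \<in> topspace X. 1/2 < g x y}) ` C" "C \<subseteq> \<Union>\<F>"
    by blast
  obtain T where "T \<subseteq> C" "finite T" "\<F> = (\<lambda>x. {y \<in> topspace X. 1/2 < g x y}) ` T"
    using finite_subset_image[OF \<F>(1,2)] by blast
  with \<F>(3) have T: "finite T" "T \<subseteq> C" "C \<subseteq> (\<Union>x\<in>T. {y. 1/2 < g x y})" by blast+
  define G where "G j y = min 1 (\<Sum>x\<in>{x\<in>T. N x = j}. 2 * g x y)" for j y
  have Gc: "G j \<in> bounded_continuous X" for j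
    unfolding G_def
    using T(2) by (auto intro!: bounded_continuous_min bounded_continuous_sum bounded_continuous_cmult gc)
  have G0: "0 \<le> G j y" for j y
    unfolding G_def using T(2) g01 by (auto intro!: sum_nonneg)
  have Gb: "G j \<in> below (U j)" for j
  proof (rule belowI[OF Gc G0])
    show "G j x \<le> 1" for x by (simp add: G_def)
    show "G j x = 0" if "x \<notin> U j" for x
      unfolding G_def using g(3)[OF _ , of _ x] that T(2) by (subst sum.neutral) auto
  qed
  define J where "J = N ` T"
  have J: "finite J" using T(1) by (simp add: J_def)
  define S where "S y = (\<Sum>j\<in>J. G j y)" for y
  have Sc: "S \<in> bounded_continuous X" unfolding S_def by (intro bounded_continuous_sum Gc)
  have S0: "0 \<le> S y" for y unfolding S_def by (intro sum_nonneg G0)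
  have S1: "1 \<le> S y" if y: "y \<in> C" for y
  proof -
    obtain x where x: "x \<in> T" "1/2 < g x y" using subsetD[OF T(3) y] by blast
    have "1 \<le> 2 * g x y" using x(2) by simp
    also have "\<dots> \<le> (\<Sum>z\<in>{z\<in>T. N z = N x}. 2 * g z y)"
      using T x(1) g01 by (intro member_le_sum) auto
    finally have "1 \<le> G (N x) y" by (simp add: G_def)
    also have "\<dots> \<le> S y" unfolding S_def using J x(1) G0 by (intro member_le_sum) (auto simp: J_def)
    finally show ?thesis .
  qed
  define u where "u y = max 0 (f y - S y - e)" for y
  have uc: "u \<in> bounded_continuous X"
    unfolding u_def by (intro bounded_continuous_max bounded_continuous_diff f'(1) Sc bounded_continuous_const)
  have "\<Lambda> u \<le> e"
  proof (rule K(2)[OF uc])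
    show "0 \<le> u x \<and> u x \<le> 1" for x
      using f'(2,3)[of x] S0[of x] e by (auto simp: u_def)
    show "u x = 0" if "x \<in> K" for x
      using S1[of x] f'(3)[of x] S0[of x] e that by (cases "x \<in> C") (auto simp: u_def C_def)
  qed
  have "\<Lambda> f \<le> \<Lambda> (\<lambda>x. u x + (S x + e))"
    by (intro mono f'(1) bounded_continuous_add uc Sc bounded_continuous_const) (auto simp: u_def)
  also have "\<dots> = \<Lambda> u + (\<Lambda> S + e)"
    by (simp add: add bounded_continuous_add uc Sc bounded_continuous_const const)
  also have "\<dots> \<le> \<Lambda> S + d" using \<open>\<Lambda> u \<le> e\<close> by (simp add: e_def)
  finally have "\<Lambda> f \<le> \<Lambda> S + d" .
  have "ennreal (\<Lambda> S) = (\<Sum>j\<in>J. ennreal (\<Lambda> (G j)))"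
    unfolding S_def by (subst sum[OF Gc]) (simp add: sum_ennreal \<Lambda>_below(1)[OF Gb])
  also have "\<dots> \<le> (\<Sum>j\<in>J. mass (U j))" by (intro sum_mono mass_ge Gb)
  also have "\<dots> \<le> (\<Sum>n. mass (U n))" by (intro sum_le_suminf J) auto
  finally have "ennreal (\<Lambda> S) \<le> (\<Sum>n. mass (U n))" .
  moreover have "ennreal (\<Lambda> f) \<le> ennreal (\<Lambda> S) + ennreal d"
    using \<open>\<Lambda> f \<le> \<Lambda> S + d\<close> d nonneg[OF Sc S0] by (simp flip: ennreal_plus)
  ultimately show "ennreal (\<Lambda> f) \<le> (\<Sum>n. mass (U n)) + ennreal d"
    by (meson add_right_mono order_trans)
qed

lemma outer_openin: "openin X U \<Longrightarrow> outer U = mass U"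
  unfolding outer_def by (intro antisym INF_lower INF_greatest) (auto intro: mass_mono)

lemma outer_mono: "A \<subseteq> B \<Longrightarrow> outer A \<le> outer B"
  unfolding outer_def by (rule INF_superset_mono) auto

lemma outer_le_1: "outer A \<le> 1"
  using outer_mono[of A UNIV] outer_openin[of UNIV] mass_le_1[of UNIV] openin_topspace[of X]
  by (simp add: topspace_UNIV)

lemma outer_approx:
  assumes "0 < e"
  obtains U where "openin X U" "A \<subseteq> U" "mass U \<le> outer A + ennreal e"
proof -
  have "outer A \<noteq> \<infinity>" using outer_le_1[of A] by (auto simp: top_unique)
  then show ?thesis
    using INF_approx_ennreal[of e "outer A" mass "{U. openin X U \<and> A \<subseteq> U}"] assms that
    by (auto simp: outer_def intro: less_imp_le)
qed

lemma outer_countably_subadditive: "outer (\<Union>n. A n) \<le> (\<Sum>n::nat. outer (A n))"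
proof (rule ennreal_le_epsilon)
  fix e :: real assume e: "0 < e"
  have "\<exists>U. openin X U \<and> A n \<subseteq> U \<and> mass U \<le> outer (A n) + ennreal (e * (1/2) ^ Suc n)" for n
    using e outer_approx[of "e * (1/2) ^ Suc n" "A n"] by auto
  then obtain U where U: "\<And>n. openin X (U n)" "\<And>n. A n \<subseteq> U n"
    "\<And>n. mass (U n) \<le> outer (A n) + ennreal (e * (1/2) ^ Suc n)" by metis
  have half: "(\<Sum>n. ennreal (e * (1/2) ^ Suc n)) = ennreal e"
    using e sums_mult[OF power_half_series, of e] by (subst suminf_ennreal_eq) auto
  have "outer (\<Union>n. A n) \<le> outer (\<Union>n. U n)" using U(2) by (intro outer_mono) auto
  also have "\<dots> = mass (\<Union>n. U n)" using U(1) by (intro outer_openin) auto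
  also have "\<dots> \<le> (\<Sum>n. mass (U n))" by (rule mass_countably_subadditive[OF U(1)])
  also have "\<dots> \<le> (\<Sum>n. outer (A n) + ennreal (e * (1/2) ^ Suc n))"
    by (intro suminf_le U(3)) auto
  also have "\<dots> = (\<Sum>n. outer (A n)) + ennreal e"
    by (subst suminf_add[symmetric]) (auto simp only: half summableI)
  finally show "outer (\<Union>n. A n) \<le> (\<Sum>n. outer (A n)) + ennreal e" .
qed

lemma outer_empty: "outer {} = 0"
proof -
  have "ennreal (\<Lambda> f) = 0" if "f \<in> below {}" for f
  proof -
    have "f = (\<lambda>_. 0)" using belowD(4)[OF that] by auto
    then show ?thesis using const[of 0] by simp
  qed
  then have "mass {} = 0" by (auto simp: mass_def bot_ennreal intro!: antisym SUP_least)
  then show ?thesis by (simp add: outer_openin)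
qed

text \<open>
  The Caratheodory condition for an open \<open>U\<close>, tested on open sets. If \<open>f\<close> is nearly optimal for
  \<open>V \<inter> U\<close>, then \<open>V - U\<close> is contained in the open set \<open>W\<close> where \<open>f < e\<close>; a function \<open>g\<close> below \<open>W\<close> can
  be added to \<open>f\<close> without exceeding \<open>1 + e\<close>.
\<close>

lemma mass_split:
  assumes U: "openin X U" and V: "openin X V"
  shows "mass (V \<inter> U) + outer (V - U) \<le> mass V"
proof (rule ennreal_le_epsilon)
  fix d :: real assume d: "0 < d"
  define e where "e = d / 3"
  have e: "0 < e" using d by (simp add: e_def)
  obtain f where f: "f \<in> below (V \<inter> U)" "mass (V \<inter> U) \<le> ennreal (\<Lambda> f + e)"
    using mass_approx[OF e] by blast
  define W where "W = V \<inter> {x. f x < e}"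
  have W: "openin X W"
    unfolding W_def using V continuous_map_openin_less(2)[of X f e] belowD(1)[OF f(1)] topspace_UNIV
    by (intro openin_Int) (auto simp: bounded_continuous_iff)
  obtain g where g: "g \<in> below W" "mass W \<le> ennreal (\<Lambda> g + e)"
    using mass_approx[OF e] by blast
  note fg = belowD(1)[OF f(1)] belowD(1)[OF g(1)]
  define k where "k x = inverse (1 + e) * (f x + g x)" for x
  have kc: "k \<in> bounded_continuous X"
    unfolding k_def by (intro bounded_continuous_cmult bounded_continuous_add fg)
  have k: "k \<in> below V"
  proof (rule belowI[OF kc])
    show "0 \<le> k x" for x using belowD(2)[OF f(1)] belowD(2)[OF g(1)] e by (auto simp: k_def)
    have "f x + g x \<le> 1 + e" for x
      using belowD(3)[OF f(1), of x] belowD(3,4)[OF g(1), of x] e by (cases "x \<in> W") (auto simp: W_def)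
    then show "k x \<le> 1" for x using e by (simp add: k_def field_simps)
    show "k x = 0" if "x \<notin> V" for x
      using belowD(4)[OF f(1), of x] belowD(4)[OF g(1), of x] that by (auto simp: k_def W_def)
  qed
  have "\<Lambda> k = inverse (1 + e) * (\<Lambda> f + \<Lambda> g)"
    unfolding k_def by (simp add: cmult add bounded_continuous_add fg)
  then have "\<Lambda> f + \<Lambda> g = \<Lambda> k + e * \<Lambda> k" using e by (simp add: field_simps)
  also have "\<dots> \<le> \<Lambda> k + e" using \<Lambda>_below(2)[OF k] e by simp
  finally have le: "(\<Lambda> f + e) + (\<Lambda> g + e) \<le> \<Lambda> k + d" by (simp add: e_def)
  have "V - U \<subseteq> W" using belowD(4)[OF f(1)] e by (auto simp: W_def)
  then have "outer (V - U) \<le> mass W" using outer_mono outer_openin[OF W] by metis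
  then have "mass (V \<inter> U) + outer (V - U) \<le> ennreal (\<Lambda> f + e) + ennreal (\<Lambda> g + e)"
    using f(2) g(2) by (meson add_mono order_trans)
  also have "\<dots> \<le> ennreal (\<Lambda> k) + ennreal d"
    using le e d \<Lambda>_below(1)[OF f(1)] \<Lambda>_below(1)[OF g(1)] \<Lambda>_below(1)[OF k] by (simp flip: ennreal_plus)
  also have "\<dots> \<le> mass V + ennreal d" by (intro add_right_mono mass_ge k)
  finally show "mass (V \<inter> U) + outer (V - U) \<le> mass V + ennreal d" .
qed

text \<open>The representing measure: the outer measure restricted to the Borel sets.\<close>

definition measure_rep :: "'x measure" where
  "measure_rep = measure_of UNIV {U. openin X U} outer"

lemma space_measure_rep: "space measure_rep = UNIV"
  and sets_measure_rep: "sets measure_rep = sets (borel_algebra X)"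
  by (auto simp: measure_rep_def sets_borel_algebra topspace_UNIV)

lemma outer_lambda_system:
  assumes U: "openin X U"
  shows "U \<in> lambda_system UNIV (Pow UNIV) outer"
proof -
  have "outer (U \<inter> A) + outer ((UNIV - U) \<inter> A) = outer A" for A
  proof (rule antisym)
    show "outer (U \<inter> A) + outer ((UNIV - U) \<inter> A) \<le> outer A"
      unfolding outer_def[of A]
    proof (rule INF_greatest)
      fix V assume V: "V \<in> {V. openin X V \<and> A \<subseteq> V}"
      then have "outer (U \<inter> A) \<le> outer (V \<inter> U)" "outer ((UNIV - U) \<inter> A) \<le> outer (V - U)"
        by (auto intro!: outer_mono)
      then have "outer (U \<inter> A) + outer ((UNIV - U) \<inter> A) \<le> mass (V \<inter> U) + outer (V - U)"
        using outer_openin[OF openin_Int[of X V U]] U V by (auto intro!: add_mono)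
      also have "\<dots> \<le> mass V" using U V by (intro mass_split) auto
      finally show "outer (U \<inter> A) + outer ((UNIV - U) \<inter> A) \<le> mass V" .
    qed
    \<comment> \<open>Binary subadditivity is countable subadditivity for a sequence that is eventually empty.\<close>
    define B where "B n = (if n = (0::nat) then U \<inter> A else if n = 1 then (UNIV - U) \<inter> A else {})" for n
    have "A \<subseteq> (\<Union>n. B n)"
    proof
      fix x assume "x \<in> A"
      then have "x \<in> B 0 \<or> x \<in> B 1" by (auto simp: B_def)
      then show "x \<in> (\<Union>n. B n)" by blast
    qed
    then have "outer A \<le> (\<Sum>n. outer (B n))"
      using outer_mono outer_countably_subadditive order_trans by metis
    also have "\<dots> = (\<Sum>n\<in>{0,1}. outer (B n))"
      by (rule suminf_finite) (auto simp: B_def outer_empty)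
    also have "\<dots> = outer (U \<inter> A) + outer ((UNIV - U) \<inter> A)" by (simp add: B_def)
    finally show "outer A \<le> outer (U \<inter> A) + outer ((UNIV - U) \<inter> A)" .
  qed
  then show ?thesis by (simp add: lambda_system_def)
qed

lemma emeasure_measure_rep:
  assumes "A \<in> sets (borel_algebra X)"
  shows "emeasure measure_rep A = outer A"
proof -
  let ?L = "lambda_system UNIV (Pow UNIV) outer"
  have "outer_measure_space (Pow UNIV) outer"
    unfolding outer_measure_space_def positive_def increasing_def countably_subadditive_def
    using outer_empty outer_mono outer_countably_subadditive by auto
  then have ms: "measure_space UNIV ?L outer"
    using sigma_algebra.caratheodory_lemma[OF sigma_algebra_Pow] by blast
  then have L: "sigma_algebra UNIV ?L" by (simp add: measure_space_def)
  have sub: "sigma_sets UNIV {U. openin X U} \<subseteq> ?L"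
    using outer_lambda_system by (intro sigma_algebra.sigma_sets_subset[OF L]) auto
  have "measure_space UNIV (sigma_sets UNIV {U. openin X U}) outer"
    by (rule measure_down[OF ms sigma_algebra_sigma_sets sub]) auto
  then show ?thesis
    using assms
    by (intro emeasure_measure_of[OF measure_rep_def])
      (auto simp: measure_space_def sets_measure_rep sets_borel_algebra topspace_UNIV)
qed

lemma emeasure_openin: "openin X U \<Longrightarrow> emeasure measure_rep U = mass U"
  using emeasure_measure_rep[of U] outer_openin[of U]
  by (simp add: sets_borel_algebra sigma_sets.Basic)

lemma prob_space_measure_rep: "prob_space measure_rep"
proof
  have o: "openin X UNIV" using openin_topspace[of X] by (simp add: topspace_UNIV)
  have "1 \<le> mass UNIV"
    using mass_ge[OF belowI[of "\<lambda>_. 1" UNIV]] one by (simp add: bounded_continuous_const)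
  then show "emeasure measure_rep (space measure_rep) = 1"
    using emeasure_openin[OF o] mass_le_1[of UNIV] by (simp add: space_measure_rep)
qed

text \<open>
  For a nonnegative lower semicontinuous \<open>r\<close>, bounds on \<open>\<Lambda>\<close> below \<open>r\<close> carry over to the integral of
  \<open>r\<close>. This is a discretised layer-cake formula: \<open>n * r\<close> is, up to 1, the sum of the indicators of
  the open sets where \<open>r > (k + 1) / n\<close>, and continuous functions below these indicators add up to a
  continuous function below \<open>n * r\<close>.
\<close>

lemma nn_integral_le:
  assumes op: "\<And>c. openin X {x. c < r x}" and r0: "\<And>x. 0 \<le> r x"
    and M: "\<And>g. g \<in> bounded_continuous X \<Longrightarrow> (\<And>x. 0 \<le> g x) \<Longrightarrow> (\<And>x. g x \<le> r x) \<Longrightarrow> \<Lambda> g \<le> M"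
  shows "(\<integral>\<^sup>+ x. ennreal (r x) \<partial>measure_rep) \<le> ennreal M"
proof -
  have M0: "0 \<le> M" using M[OF bounded_continuous_const, of 0] r0 const[of 0] by simp
  define I where "I = (\<integral>\<^sup>+ x. ennreal (r x) \<partial>measure_rep)"
  have step: "ennreal n * I \<le> ennreal (1 + n * M)" if n: "0 < n" for n :: nat
  proof -
    define U where "U k = {x. real (Suc k) / n < r x}" for k
    have U: "openin X (U k)" for k unfolding U_def by (rule op)
    have partial: "(\<Sum>k<N. mass (U k)) \<le> ennreal (n * M)" for N
    proof (rule ennreal_le_epsilon)
      fix d :: real assume d: "0 < d"
      define e where "e = d / Suc N"
      have e: "0 < e" using d by (simp add: e_def)
      have "\<exists>g. g \<in> below (U k) \<and> mass (U k) \<le> ennreal (\<Lambda> g + e)" for k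
        using mass_approx[OF e] by metis
      then obtain g where g: "\<And>k. g k \<in> below (U k)" "\<And>k. mass (U k) \<le> ennreal (\<Lambda> (g k) + e)" by metis
      note gc = belowD(1)[OF g(1)]
      define G where "G x = inverse n * (\<Sum>k<N. g k x)" for x
      have Gc: "G \<in> bounded_continuous X"
        unfolding G_def by (intro bounded_continuous_cmult bounded_continuous_sum gc)
      have "\<Lambda> G \<le> M"
      proof (rule M[OF Gc])
        show "0 \<le> G x" for x
          unfolding G_def using belowD(2)[OF g(1)] by (auto intro!: sum_nonneg mult_nonneg_nonneg)
        show "G x \<le> r x" for x
        proof -
          have "(\<Sum>k<N. g k x) \<le> (\<Sum>k<N. indicat_real (U k) x)"
            using g(1) by (intro sum_mono) (auto simp: below_def)
          also have "\<dots> = card {k\<in>{..<N}. x \<in> U k}"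
            by (simp add: sum.If_cases indicator_def of_bool_def Int_def)
          also have "\<dots> \<le> card {..<nat \<lfloor>n * r x\<rfloor>}"
          proof -
            have "{k\<in>{..<N}. x \<in> U k} \<subseteq> {..<nat \<lfloor>n * r x\<rfloor>}"
            proof clarsimp
              fix k assume "x \<in> U k"
              then have "real (Suc k) \<le> n * r x" using n by (simp add: U_def field_simps)
              then have "int (Suc k) \<le> \<lfloor>n * r x\<rfloor>" by (simp add: le_floor_iff)
              then show "k < nat \<lfloor>n * r x\<rfloor>" by linarith
            qed
            then show ?thesis by (intro of_nat_mono card_mono) auto
          qed
          also have "\<dots> \<le> n * r x" using r0[of x] by simp
          finally show ?thesis using n by (simp add: G_def field_simps)
        qed
      qed
      moreover have "\<Lambda> G = inverse n * (\<Sum>k<N. \<Lambda> (g k))"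
        unfolding G_def by (simp add: cmult bounded_continuous_sum gc sum)
      ultimately have "(\<Sum>k<N. \<Lambda> (g k)) \<le> n * M" using n by (simp add: field_simps)
      moreover have "N * e \<le> d" using d by (simp add: e_def field_simps)
      ultimately have le: "(\<Sum>k<N. \<Lambda> (g k) + e) \<le> n * M + d" by (simp add: sum.distrib)
      have "(\<Sum>k<N. mass (U k)) \<le> (\<Sum>k<N. ennreal (\<Lambda> (g k) + e))" by (intro sum_mono g(2))
      also have "\<dots> = ennreal (\<Sum>k<N. \<Lambda> (g k) + e)"
        using \<Lambda>_below(1)[OF g(1)] e by (intro sum_ennreal) (simp add: add_nonneg_nonneg)
      also have "\<dots> \<le> ennreal (n * M) + ennreal d"
        using le M0 d by (simp flip: ennreal_plus)
      finally show "(\<Sum>k<N. mass (U k)) \<le> ennreal (n * M) + ennreal d" .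
    qed
    have pw: "ennreal (n * r x) \<le> 1 + (\<Sum>k. indicator (U k) x)" for x
    proof -
      define N where "N = nat (\<lceil>n * r x\<rceil> - 1)"
      have in_U: "x \<in> U k" if "k < N" for k
      proof -
        have "int (Suc k) \<le> \<lceil>n * r x\<rceil> - 1" using that by (simp add: N_def)
        then have "real (Suc k) < n * r x" by linarith
        then show ?thesis using n by (simp add: U_def field_simps)
      qed
      have "n * r x \<le> 1 + real N" by (simp add: N_def) linarith
      then have "ennreal (n * r x) \<le> ennreal (1 + real N)" by (rule ennreal_leI)
      also have "\<dots> = 1 + (\<Sum>k<N. 1)" by (simp add: ennreal_plus ennreal_of_nat_eq_real_of_nat)
      also have "\<dots> = 1 + (\<Sum>k<N. indicator (U k) x)" using in_U by simp
      also have "\<dots> \<le> 1 + (\<Sum>k. indicator (U k) x)" by (intro add_left_mono sum_le_suminf) auto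
      finally show ?thesis .
    qed
    have Um: "U k \<in> sets measure_rep" for k
      using U by (simp add: sets_measure_rep sets_borel_algebra sigma_sets.Basic)
    have rm: "(\<lambda>x. ennreal (r x)) \<in> borel_measurable measure_rep"
    proof -
      have "r \<in> borel_measurable measure_rep"
        unfolding borel_measurable_iff_greater
        using op by (auto simp: space_measure_rep sets_measure_rep sets_borel_algebra intro: sigma_sets.Basic)
      then show ?thesis by simp
    qed
    have "ennreal n * I = (\<integral>\<^sup>+ x. ennreal (n * r x) \<partial>measure_rep)"
      unfolding I_def using rm r0 by (subst nn_integral_cmult[symmetric]) (auto simp: ennreal_mult)
    also have "\<dots> \<le> (\<integral>\<^sup>+ x. 1 + (\<Sum>k. indicator (U k) x) \<partial>measure_rep)"
      by (intro nn_integral_mono pw)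
    also have "\<dots> = 1 + (\<Sum>k. mass (U k))"
      using Um prob_space.emeasure_space_1[OF prob_space_measure_rep]
      by (subst nn_integral_add) (auto simp: nn_integral_suminf emeasure_openin[OF U])
    also have "\<dots> \<le> 1 + ennreal (n * M)"
      by (intro add_left_mono suminf_le_const partial) auto
    also have "\<dots> = ennreal (1 + n * M)" using M0 by (simp add: ennreal_plus)
    finally show ?thesis .
  qed
  have "I < \<infinity>" using step[of 1] by (auto intro: le_less_trans)
  then obtain i where i: "I = ennreal i" "0 \<le> i" by (cases I) auto
  have "i \<le> M + 1 / Suc n" for n
  proof -
    have "ennreal (Suc n * i) = ennreal (Suc n) * I"
      unfolding i(1) by (rule ennreal_mult) (use i(2) in auto)
    also have "\<dots> \<le> ennreal (1 + Suc n * M)" using step[of "Suc n"] by blast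
    finally have "Suc n * i \<le> 1 + Suc n * M"
      by (subst (asm) ennreal_le_iff) (use M0 in simp)
    then have "Suc n * i \<le> Suc n * (M + 1 / Suc n)" by (simp add: distrib_left)
    then show ?thesis by (rule mult_left_le_imp_le) simp
  qed
  moreover have "(\<lambda>n. M + 1 / Suc n) \<longlonglongrightarrow> M + 0"
    by (intro tendsto_intros LIMSEQ_Suc lim_const_over_n)
  ultimately have "i \<le> M" using LIMSEQ_le_const by fastforce
  then show ?thesis using i by (simp add: I_def ennreal_leI)
qed

text \<open>
  Applied to nonnegative continuous functions, the preceding lemma gives one inequality; applying
  it to \<open>c + f\<close> and \<open>c - f\<close> for a bound \<open>c\<close> of \<open>f\<close> gives equality.
\<close>

lemma integral_measure_rep:
  assumes f: "f \<in> bounded_continuous X"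
  shows "integrable measure_rep f" "integral\<^sup>L measure_rep f = \<Lambda> f"
proof -
  interpret prob_space measure_rep by (rule prob_space_measure_rep)
  have int: "integrable measure_rep g" if g: "g \<in> bounded_continuous X" for g
  proof -
    obtain c where c: "\<And>x. \<bar>g x\<bar> \<le> c" using g by (auto simp: bounded_continuous_iff)
    have "g \<in> borel_measurable (borel_algebra X)"
      using g by (auto simp: bounded_continuous_iff intro: continuous_map_borel_measurable)
    then have "g \<in> borel_measurable measure_rep"
      using measurable_cong_sets[OF sets_measure_rep refl] by blast
    then show ?thesis using c by (intro integrable_const_bound[of _ c]) auto
  qed
  have le: "integral\<^sup>L measure_rep g \<le> \<Lambda> g" if g: "g \<in> bounded_continuous X" "\<And>x. 0 \<le> g x" for g
  proof -
    have "(\<integral>\<^sup>+ x. ennreal (g x) \<partial>measure_rep) \<le> ennreal (\<Lambda> g)"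
    proof (rule nn_integral_le)
      show "openin X {x. c < g x}" for c
        using continuous_map_openin_less(1)[of X g c] g(1) by (auto simp: bounded_continuous_iff topspace_UNIV)
    qed (use g mono in auto)
    then show ?thesis
      using nn_integral_eq_integral[OF int[OF g(1)]] g nonneg[OF g] by (auto simp: ennreal_le_iff)
  qed
  obtain c where c: "\<And>x. \<bar>f x\<bar> \<le> c" using f by (auto simp: bounded_continuous_iff)
  have ge: "c + f x \<ge> 0" "c - f x \<ge> 0" for x using c[of x] by auto
  have "integral\<^sup>L measure_rep (\<lambda>x. c + f x) \<le> \<Lambda> (\<lambda>x. c + f x)"
    "integral\<^sup>L measure_rep (\<lambda>x. c - f x) \<le> \<Lambda> (\<lambda>x. c - f x)"
    by (intro le bounded_continuous_add bounded_continuous_diff bounded_continuous_const f ge)+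
  then have "c + integral\<^sup>L measure_rep f \<le> c + \<Lambda> f" "c - integral\<^sup>L measure_rep f \<le> c - \<Lambda> f"
    using int[OF f] by (simp_all add: add diff const f bounded_continuous_const prob_space)
  then show "integral\<^sup>L measure_rep f = \<Lambda> f" by simp
  show "integrable measure_rep f" by (rule int[OF f])
qed

end


section \<open>Weighted spaces over an admissible weight\<close>

lemma weighted_bounded_abs_le:
  assumes "f \<in> weighted_bounded \<rho>" "0 < \<rho> x"
  shows "\<bar>f x\<bar> \<le> weighted_norm \<rho> f * \<rho> x"
proof -
  have "inverse (\<rho> x) * \<bar>f x\<bar> \<le> weighted_norm \<rho> f"
    unfolding weighted_norm_def using assms(1)
    by (intro cSUP_upper) (auto simp: weighted_bounded_def)
  then show ?thesis using assms(2) by (simp add: field_simps)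
qed

lemma weighted_boundedI:
  assumes "\<And>x. \<bar>f x\<bar> \<le> c * \<rho> x" "\<And>x. 0 < \<rho> x"
  shows "f \<in> weighted_bounded \<rho>"
proof -
  have "inverse (\<rho> x) * \<bar>f x\<bar> \<le> c" for x
    using assms(1)[of x] assms(2)[of x] by (simp add: field_simps)
  then show ?thesis by (auto simp: weighted_bounded_def intro!: bdd_aboveI[of _ c])
qed

lemma admissible_weight_openin:
  assumes "admissible_weight X \<rho>"
  shows "openin X {x. c < \<rho> x}"
proof (cases "0 < c")
  case True
  then have "closedin X {x. \<rho> x \<le> c}"
    using assms by (intro compactin_imp_closedin) (auto simp: admissible_weight_def)
  then have "openin X (topspace X - {x. \<rho> x \<le> c})" by (intro openin_diff openin_topspace)
  moreover have "topspace X - {x. \<rho> x \<le> c} = {x. c < \<rho> x}"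
    using assms by (auto simp: admissible_weight_def)
  ultimately show ?thesis by simp
next
  case False
  then have "{x. c < \<rho> x} = topspace X"
    using assms by (auto simp: admissible_weight_def intro: le_less_trans[of _ 0])
  then show ?thesis by simp
qed

lemma admissible_weight_measurable:
  assumes "admissible_weight X \<rho>"
  shows "\<rho> \<in> borel_measurable (borel_algebra X)"
  unfolding borel_measurable_iff_greater
  using admissible_weight_openin[OF assms] assms
  by (auto simp: space_borel_algebra sets_borel_algebra admissible_weight_def intro!: sigma_sets.Basic)

text \<open>
  A lower semicontinuous positive function is bounded away from 0 on the compact set \<open>\<rho> \<le> 1\<close>.
  Consequently bounded functions belong to the weighted space.
\<close>

lemma admissible_weight_bounded_below:
  assumes \<rho>: "admissible_weight X \<rho>"
  obtains d where "0 < d" "\<And>x. d \<le> \<rho> x"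
proof -
  let ?U = "\<lambda>n::nat. {x. 1 / Suc n < \<rho> x}"
  have K: "compactin X {x. \<rho> x \<le> 1}" and pos: "\<And>x. 0 < \<rho> x"
    using \<rho> by (auto simp: admissible_weight_def)
  have "\<exists>\<F>. finite \<F> \<and> \<F> \<subseteq> range ?U \<and> {x. \<rho> x \<le> 1} \<subseteq> \<Union>\<F>"
  proof (rule compactinD[OF K])
    show "openin X W" if "W \<in> range ?U" for W using that admissible_weight_openin[OF \<rho>] by auto
    show "{x. \<rho> x \<le> 1} \<subseteq> \<Union>(range ?U)"
    proof
      fix x
      obtain n where "1 / real (Suc n) < \<rho> x" using nat_approx_posE[OF pos] by metis
      then show "x \<in> \<Union>(range ?U)" by blast
    qed
  qed
  then obtain \<F> where \<F>: "finite \<F>" "\<F> \<subseteq> range ?U" "{x. \<rho> x \<le> 1} \<subseteq> \<Union>\<F>" by blast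
  obtain T where "finite T" "\<F> = ?U ` T" using finite_subset_image[OF \<F>(1,2)] by blast
  with \<F>(3) have T: "finite T" "{x. \<rho> x \<le> 1} \<subseteq> (\<Union>n\<in>T. ?U n)" by blast+
  define m where "m = Max (insert 0 T)"
  have m: "n \<le> m" if "n \<in> T" for n using that T(1) by (simp add: m_def)
  have "1 / Suc m \<le> \<rho> x" for x
  proof (cases "\<rho> x \<le> 1")
    case True
    then obtain n where n: "n \<in> T" "1 / Suc n < \<rho> x" using T(2) by auto
    have "1 / real (Suc m) \<le> 1 / Suc n" using m[OF n(1)] by (intro divide_left_mono) auto
    then show ?thesis using n(2) by linarith
  next
    case False
    moreover have "1 / real (Suc m) \<le> 1" by simp
    ultimately show ?thesis by linarith
  qed
  then show ?thesis by (intro that[of "1 / Suc m"]) auto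
qed

lemma bounded_continuous_le_weight:
  assumes \<rho>: "admissible_weight X \<rho>" and f: "f \<in> bounded_continuous X"
  obtains c where "\<And>x. \<bar>f x\<bar> \<le> c * \<rho> x"
proof -
  obtain d where d: "0 < d" "\<And>x. d \<le> \<rho> x" using admissible_weight_bounded_below[OF \<rho>] by blast
  obtain a where a: "\<And>x. \<bar>f x\<bar> \<le> a" using f by (auto simp: bounded_continuous_iff)
  have "\<bar>f x\<bar> \<le> (\<bar>a\<bar> / d) * \<rho> x" for x
  proof -
    have "\<bar>f x\<bar> \<le> (\<bar>a\<bar> / d) * d" using a[of x] d(1) by simp
    also have "\<dots> \<le> (\<bar>a\<bar> / d) * \<rho> x" using d by (intro mult_left_mono) auto
    finally show ?thesis .
  qed
  then show ?thesis by (rule that)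
qed

lemma bounded_continuous_in_weighted_closure:
  assumes \<rho>: "admissible_weight X \<rho>" and f: "f \<in> bounded_continuous X"
  shows "f \<in> weighted_closure X \<rho>"
proof -
  obtain c where "\<And>x. \<bar>f x\<bar> \<le> c * \<rho> x" using bounded_continuous_le_weight[OF \<rho> f] by blast
  then have "f \<in> weighted_bounded \<rho>"
    using \<rho> by (intro weighted_boundedI) (auto simp: admissible_weight_def)
  moreover have "weighted_norm \<rho> (\<lambda>x. f x - f x) = 0" by (simp add: weighted_norm_def)
  ultimately show ?thesis using f by (auto simp: weighted_closure_def intro!: bexI[of _ f])
qed

lemma weighted_closure_le_weight:
  assumes \<rho>: "admissible_weight X \<rho>" and f: "f \<in> weighted_closure X \<rho>"
  obtains c where "0 \<le> c" "\<And>x. \<bar>f x\<bar> \<le> c * \<rho> x"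
proof
  have pos: "0 < \<rho> x" for x using \<rho> by (simp add: admissible_weight_def)
  show "\<bar>f x\<bar> \<le> max 0 (weighted_norm \<rho> f) * \<rho> x" for x
  proof -
    have "\<bar>f x\<bar> \<le> weighted_norm \<rho> f * \<rho> x"
      using f pos by (intro weighted_bounded_abs_le) (auto simp: weighted_closure_def)
    also have "\<dots> \<le> max 0 (weighted_norm \<rho> f) * \<rho> x"
      using pos[of x] by (intro mult_right_mono) auto
    finally show ?thesis .
  qed
qed simp

lemma weighted_closure_approx:
  assumes \<rho>: "admissible_weight X \<rho>" and f: "f \<in> weighted_closure X \<rho>" and e: "0 < e"
  obtains g where "g \<in> bounded_continuous X" "\<And>x. \<bar>f x - g x\<bar> \<le> e * \<rho> x"
proof -
  have pos: "0 < \<rho> x" for x using \<rho> by (simp add: admissible_weight_def)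
  obtain g where g: "g \<in> bounded_continuous X" "weighted_norm \<rho> (\<lambda>x. f x - g x) < e"
    using f e by (auto simp: weighted_closure_def)
  obtain a where a: "\<And>x. \<bar>f x\<bar> \<le> a * \<rho> x" using weighted_closure_le_weight[OF \<rho> f] by blast
  obtain b where b: "\<And>x. \<bar>g x\<bar> \<le> b * \<rho> x" using bounded_continuous_le_weight[OF \<rho> g(1)] by blast
  have "\<bar>f x - g x\<bar> \<le> (a + b) * \<rho> x" for x
    using a[of x] b[of x] abs_triangle_ineq4[of "f x" "g x"] by (simp add: distrib_right)
  then have wb: "(\<lambda>x. f x - g x) \<in> weighted_bounded \<rho>" using pos by (rule weighted_boundedI)
  have "\<bar>f x - g x\<bar> \<le> e * \<rho> x" for x
  proof -
    have "\<bar>f x - g x\<bar> \<le> weighted_norm \<rho> (\<lambda>x. f x - g x) * \<rho> x"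
      by (rule weighted_bounded_abs_le[OF wb pos])
    also have "\<dots> \<le> e * \<rho> x" using g(2) pos[of x] by (intro mult_right_mono) auto
    finally show ?thesis .
  qed
  with g(1) show ?thesis by (rule that)
qed

lemma weighted_closure_measurable:
  assumes \<rho>: "admissible_weight X \<rho>" and f: "f \<in> weighted_closure X \<rho>"
  shows "f \<in> borel_measurable (borel_algebra X)"
proof -
  have "\<exists>g. g \<in> bounded_continuous X \<and> (\<forall>x. \<bar>f x - g x\<bar> \<le> 1 / Suc n * \<rho> x)" for n
    using weighted_closure_approx[OF \<rho> f, of "1 / Suc n"] by (metis of_nat_0_less_iff zero_less_Suc zero_less_divide_1_iff)
  then obtain g where g: "\<And>n. g n \<in> bounded_continuous X" "\<And>n x. \<bar>f x - g n x\<bar> \<le> 1 / Suc n * \<rho> x"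
    by metis
  show ?thesis
  proof (rule borel_measurable_LIMSEQ_real)
    show "g n \<in> borel_measurable (borel_algebra X)" for n
      using g(1)[of n] by (auto simp: bounded_continuous_iff intro: continuous_map_borel_measurable)
    show "(\<lambda>n. g n x) \<longlonglongrightarrow> f x" for x
    proof -
      have lim: "(\<lambda>n. \<rho> x / Suc n) \<longlonglongrightarrow> 0"
        by (rule LIMSEQ_Suc[OF lim_const_over_n])
      have "(\<lambda>n. g n x - f x) \<longlonglongrightarrow> 0"
      proof (rule tendsto_0_le[OF lim, of _ 1], intro always_eventually allI)
        show "norm (g n x - f x) \<le> norm (\<rho> x / Suc n) * 1" for n
          using g(2)[of x n] \<rho> by (simp add: admissible_weight_def abs_minus_commute abs_of_pos)
      qed
      then show ?thesis by (simp add: LIM_zero_iff)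
    qed
  qed
qed

lemma abs_integral_le_weight:
  assumes \<rho>: "\<rho> \<in> borel_measurable N" "\<And>x. 0 \<le> \<rho> x" "(\<integral>\<^sup>+ x. ennreal (\<rho> x) \<partial>N) \<le> ennreal B"
    and B: "0 \<le> B" and c: "0 \<le> c"
    and f: "integrable N f" "\<And>x. \<bar>f x\<bar> \<le> c * \<rho> x"
  shows "\<bar>integral\<^sup>L N f\<bar> \<le> c * B"
proof -
  have int: "integrable N \<rho>"
    using \<rho> by (intro integrableI_nonneg) (auto intro: le_less_trans)
  then have "integral\<^sup>L N \<rho> \<le> B"
    using \<rho> B by (auto simp: nn_integral_eq_integral ennreal_le_iff)
  have "\<bar>integral\<^sup>L N f\<bar> \<le> integral\<^sup>L N (\<lambda>x. \<bar>f x\<bar>)" by (rule integral_abs_bound)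
  also have "\<dots> \<le> integral\<^sup>L N (\<lambda>x. c * \<rho> x)"
    using f int by (intro integral_mono) auto
  also have "\<dots> \<le> c * B" using \<open>integral\<^sup>L N \<rho> \<le> B\<close> c by (simp add: mult_left_mono)
  finally show ?thesis .
qed


section \<open>Existence of invariant measures\<close>

theorem generalised_feller_process_invariant_measure:
  assumes \<rho>: "admissible_weight X \<rho>" and proc: "generalised_feller_process X \<rho> P M \<xi>"
    and B: "\<And>t. 0 \<le> t \<Longrightarrow> (\<integral>\<^sup>+ \<omega>. ennreal (\<rho> (\<xi> t \<omega>)) \<partial>M) \<le> ennreal B" "0 \<le> B"
  shows "\<exists>\<mu>. invariant_measure X \<rho> P \<mu>"
proof -
  let ?D = "weighted_closure X \<rho>"
  define \<gamma> where "\<gamma> t = distr M (borel_algebra X) (\<xi> t)" for t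
  define m where "m \<phi> t = integral\<^sup>L (\<gamma> t) \<phi>" for \<phi> :: "_ \<Rightarrow> real" and t
  have M: "prob_space M" and \<xi>: "\<And>t. 0 \<le> t \<Longrightarrow> \<xi> t \<in> measurable M (borel_algebra X)"
    and adj: "\<And>t. 0 \<le> t \<Longrightarrow> adjoint_image X \<rho> (P t) (\<gamma> 0) (\<gamma> t)"
    and semi: "generalised_feller_semigroup X \<rho> P"
    using proc by (auto simp: generalised_feller_process_def \<gamma>_def)
  have PD: "P t \<phi> \<in> ?D" if "0 \<le> t" "\<phi> \<in> ?D" for t \<phi>
    using semi that by (auto simp: generalised_feller_semigroup_def bounded_operator_def)
  have P_add: "P (t + s) \<phi> = P t (P s \<phi>)" if "0 \<le> t" "0 \<le> s" "\<phi> \<in> ?D" for t s \<phi>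
    using semi that by (auto simp: generalised_feller_semigroup_def)
  have pos: "0 < \<rho> x" for x using \<rho> by (simp add: admissible_weight_def)
  note CD = bounded_continuous_in_weighted_closure[OF \<rho>]
  note \<rho>_meas = admissible_weight_measurable[OF \<rho>]
  have int: "integrable (\<gamma> t) \<phi>" if "0 \<le> t" "\<phi> \<in> ?D" for t \<phi>
    using adj[OF that(1)] that(2) by (auto simp: adjoint_image_def)
  have m_shift: "m (P s \<phi>) t = m \<phi> (t + s)" if "0 \<le> t" "0 \<le> s" "\<phi> \<in> ?D" for t s \<phi>
  proof -
    have "m (P s \<phi>) t = integral\<^sup>L (\<gamma> 0) (P t (P s \<phi>))"
      using adj[OF that(1)] PD[OF that(2,3)] by (auto simp: adjoint_image_def m_def)
    also have "\<dots> = m \<phi> (t + s)"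
      using adj[of "t + s"] that by (auto simp: adjoint_image_def m_def P_add)
    finally show ?thesis .
  qed
  have \<gamma>_bound: "(\<integral>\<^sup>+ x. ennreal (\<rho> x) \<partial>\<gamma> t) \<le> ennreal B" if "0 \<le> t" for t
    using B(1)[OF that] \<rho>_meas unfolding \<gamma>_def by (simp add: nn_integral_distr[OF \<xi>[OF that]])
  have m_bound: "\<bar>integral\<^sup>L (\<gamma> t) f\<bar> \<le> c * B"
    if "0 \<le> t" "integrable (\<gamma> t) f" "0 \<le> c" "\<And>x. \<bar>f x\<bar> \<le> c * \<rho> x" for t f c
    using that \<rho>_meas pos \<gamma>_bound[OF that(1)] B(2)
    by (intro abs_integral_le_weight[of \<rho>]) (auto simp: \<gamma>_def less_imp_le)
  have bd: "bounded (m \<phi> ` {0..})" if \<phi>: "\<phi> \<in> ?D" for \<phi>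
  proof -
    obtain c where "0 \<le> c" "\<And>x. \<bar>\<phi> x\<bar> \<le> c * \<rho> x" using weighted_closure_le_weight[OF \<rho> \<phi>] by blast
    then show ?thesis
      using m_bound[OF _ int[OF _ \<phi>], of _ c] by (auto simp: bounded_image_real_iff m_def)
  qed
  obtain L where L: "mean_on {0::real..} L"
    and L_shift: "\<And>s F. s \<in> {0..} \<Longrightarrow> bounded (F ` {0..}) \<Longrightarrow> L (\<lambda>t. F (t + s)) = L F"
    using invariant_mean_exists[of "{0::real..}"] by auto
  define \<Lambda> where "\<Lambda> \<phi> = L (m \<phi>)" for \<phi>
  have \<Lambda>_diff: "\<bar>\<Lambda> f - \<Lambda> g\<bar> \<le> c * B"
    if "f \<in> ?D" "g \<in> ?D" "0 \<le> c" "\<And>x. \<bar>f x - g x\<bar> \<le> c * \<rho> x" for f g c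
    unfolding \<Lambda>_def
  proof (rule mean_on_diff_abs_le[OF L bd[OF that(1)] bd[OF that(2)]])
    fix t :: real assume t: "t \<in> {0..}"
    then have "m f t - m g t = integral\<^sup>L (\<gamma> t) (\<lambda>x. f x - g x)"
      using int that(1,2) by (simp add: m_def)
    then show "\<bar>m f t - m g t\<bar> \<le> c * B"
      using m_bound[of t "\<lambda>x. f x - g x" c] int t that by simp
  qed
  have \<Lambda>_zero: "\<Lambda> (\<lambda>_. 0) = 0"
    using mean_on_const[OF L, of 0] by (simp add: \<Lambda>_def m_def[abs_def])
  have \<Lambda>_le: "\<Lambda> f \<le> c * B" if "f \<in> ?D" "0 \<le> c" "\<And>x. \<bar>f x\<bar> \<le> c * \<rho> x" for f c
    using \<Lambda>_diff[OF that(1) CD[OF bounded_continuous_const], of c 0] that \<Lambda>_zero by auto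
  \<comment> \<open>Functions on \<open>real\<close> that agree on \<open>[0, \<infinity>)\<close> have the same mean.\<close>
  have agree: "L F = L G" if "\<And>t. 0 \<le> t \<Longrightarrow> F t = G t" "bounded (F ` {0..})" for F G
  proof -
    have "bounded (G ` {0..})" using that by (simp add: bounded_image_real_iff)
    then show ?thesis using mean_on_diff_abs_le[OF L that(2), of G 0] that(1) by simp
  qed
  interpret \<Lambda>: tight_functional X \<Lambda>
  proof
    show "topspace X = UNIV" "completely_regular_space X"
      using \<rho> by (auto simp: admissible_weight_def)
    show "\<Lambda> (\<lambda>x. f x + g x) = \<Lambda> f + \<Lambda> g"
      if f: "f \<in> bounded_continuous X" and g: "g \<in> bounded_continuous X" for f g
    proof -
      have "L (m (\<lambda>x. f x + g x)) = L (\<lambda>t. m f t + m g t)"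
        using int CD f g by (intro agree bd CD[OF bounded_continuous_add]) (auto simp: m_def)
      also have "\<dots> = L (m f) + L (m g)"
        using L bd[OF CD[OF f]] bd[OF CD[OF g]] unfolding mean_on_def by blast
      finally show ?thesis by (simp add: \<Lambda>_def)
    qed
    show "\<Lambda> (\<lambda>x. c * f x) = c * \<Lambda> f" if f: "f \<in> bounded_continuous X" for f c
    proof -
      have "m (\<lambda>x. c * f x) = (\<lambda>t. c * m f t)" by (auto simp: m_def)
      moreover have "L (\<lambda>t. c * m f t) = c * L (m f)"
        using L bd[OF CD[OF f]] unfolding mean_on_def by blast
      ultimately show ?thesis by (simp add: \<Lambda>_def)
    qed
    show "0 \<le> \<Lambda> f" if "f \<in> bounded_continuous X" "\<And>x. 0 \<le> f x" for f
      using L bd[OF CD[OF that(1)]] that(2) unfolding mean_on_def \<Lambda>_def m_def by simp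
    show "\<Lambda> (\<lambda>_. 1) = 1"
    proof -
      have "m (\<lambda>_. 1) t = 1" if "0 \<le> t" for t
        using prob_space.prob_space[OF prob_space.prob_space_distr[OF M \<xi>[OF that]]]
        by (simp add: m_def \<gamma>_def)
      then have "L (m (\<lambda>_. 1)) = L (\<lambda>_. 1)"
        by (intro agree bd CD bounded_continuous_const) auto
      then show ?thesis by (simp add: \<Lambda>_def mean_on_const[OF L])
    qed
    show "\<exists>K. compactin X K \<and> (\<forall>f\<in>bounded_continuous X.
        (\<forall>x. 0 \<le> f x \<and> f x \<le> 1) \<longrightarrow> (\<forall>x\<in>K. f x = 0) \<longrightarrow> \<Lambda> f \<le> e)" if e: "0 < e" for e
    proof -
      \<comment> \<open>Markov's inequality: a function between 0 and 1 vanishing where \<open>\<rho> \<le> R\<close> is at most \<open>\<rho> / R\<close>.\<close>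
      define R where "R = (B + 1) / e"
      have R: "0 < R" using e B(2) by (simp add: R_def)
      have "\<Lambda> f \<le> e" if f: "f \<in> bounded_continuous X" "\<forall>x. 0 \<le> f x \<and> f x \<le> 1"
        "\<forall>x\<in>{x. \<rho> x \<le> R}. f x = 0" for f
      proof -
        have "\<bar>f x\<bar> \<le> inverse R * \<rho> x" for x
        proof (cases "\<rho> x \<le> R")
          case True then show ?thesis using f(3) R pos[of x] by simp
        next
          case False
          then have "1 \<le> inverse R * \<rho> x" using R by (simp add: field_simps)
          then show ?thesis using f(2) by (smt (verit))
        qed
        then have "\<Lambda> f \<le> inverse R * B" using \<Lambda>_le[OF CD[OF f(1)]] R by simp
        also have "\<dots> \<le> e" using e B(2) by (simp add: R_def field_simps)
        finally show ?thesis .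
      qed
      moreover have "compactin X {x. \<rho> x \<le> R}" using \<rho> R by (simp add: admissible_weight_def)
      ultimately show ?thesis by blast
    qed
  qed
  define \<mu> where "\<mu> = \<Lambda>.measure_rep"
  have sets_\<mu>: "sets \<mu> = sets (borel_algebra X)" by (simp add: \<mu>_def \<Lambda>.sets_measure_rep)
  have \<rho>_\<mu>: "\<rho> \<in> borel_measurable \<mu>"
    using \<rho>_meas measurable_cong_sets[OF sets_\<mu> refl] by blast
  have \<mu>_bound: "(\<integral>\<^sup>+ x. ennreal (\<rho> x) \<partial>\<mu>) \<le> ennreal B"
    unfolding \<mu>_def
  proof (rule \<Lambda>.nn_integral_le)
    show "openin X {x. c < \<rho> x}" for c by (rule admissible_weight_openin[OF \<rho>])
    show "0 \<le> \<rho> x" for x using pos[of x] by simp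
    show "\<Lambda> g \<le> B" if "g \<in> bounded_continuous X" "\<And>x. 0 \<le> g x" "\<And>x. g x \<le> \<rho> x" for g
      using \<Lambda>_le[OF CD[OF that(1)], of 1] that by simp
  qed
  have int_\<rho>: "integrable \<mu> \<rho>"
    using \<rho>_\<mu> pos \<mu>_bound by (intro integrableI_nonneg) (auto intro: le_less_trans less_imp_le)
  have int_\<mu>: "integrable \<mu> \<phi>" if \<phi>: "\<phi> \<in> ?D" for \<phi>
  proof -
    obtain c where c: "0 \<le> c" "\<And>x. \<bar>\<phi> x\<bar> \<le> c * \<rho> x" using weighted_closure_le_weight[OF \<rho> \<phi>] by blast
    show ?thesis
    proof (rule Bochner_Integration.integrable_bound)
      show "integrable \<mu> (\<lambda>x. c * \<rho> x)" using int_\<rho> by simp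
      show "\<phi> \<in> borel_measurable \<mu>"
        using weighted_closure_measurable[OF \<rho> \<phi>] measurable_cong_sets[OF sets_\<mu> refl] by blast
      have "norm (\<phi> x) \<le> norm (c * \<rho> x)" for x using c(2)[of x] abs_ge_self order_trans by fastforce
      then show "AE x in \<mu>. norm (\<phi> x) \<le> norm (c * \<rho> x)" by simp
    qed
  qed
  have rep: "integral\<^sup>L \<mu> \<phi> = \<Lambda> \<phi>" if \<phi>: "\<phi> \<in> ?D" for \<phi>
  proof -
    have "\<bar>integral\<^sup>L \<mu> \<phi> - \<Lambda> \<phi>\<bar> \<le> 0 + e" if e: "0 < e" for e
    proof -
      define d where "d = e / (2 * (B + 1))"
      have d: "0 < d" using e B(2) by (simp add: d_def)
      obtain g where g: "g \<in> bounded_continuous X" "\<And>x. \<bar>\<phi> x - g x\<bar> \<le> d * \<rho> x"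
        using weighted_closure_approx[OF \<rho> \<phi> d] by blast
      note g' = CD[OF g(1)]
      have "\<bar>integral\<^sup>L \<mu> (\<lambda>x. \<phi> x - g x)\<bar> \<le> d * B"
        using \<rho>_\<mu> pos \<mu>_bound B(2) d int_\<mu>[OF \<phi>] int_\<mu>[OF g'] g(2)
        by (intro abs_integral_le_weight[of \<rho>]) (auto simp: less_imp_le)
      moreover have "integral\<^sup>L \<mu> (\<lambda>x. \<phi> x - g x) = integral\<^sup>L \<mu> \<phi> - \<Lambda> g"
        using int_\<mu>[OF \<phi>] int_\<mu>[OF g'] \<Lambda>.integral_measure_rep(2)[OF g(1)] by (simp add: \<mu>_def)
      moreover have "\<bar>\<Lambda> \<phi> - \<Lambda> g\<bar> \<le> d * B"
        using \<Lambda>_diff[OF \<phi> g' _ g(2)] d by simp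
      moreover have "2 * (d * B) \<le> e" using e B(2) by (simp add: d_def field_simps)
      ultimately show ?thesis by linarith
    qed
    then have "\<bar>integral\<^sup>L \<mu> \<phi> - \<Lambda> \<phi>\<bar> \<le> 0" by (rule field_le_epsilon)
    then show ?thesis by simp
  qed
  have "integral\<^sup>L \<mu> (P s \<phi>) = integral\<^sup>L \<mu> \<phi>" if "0 \<le> s" "\<phi> \<in> ?D" for s \<phi>
  proof -
    have "L (m (P s \<phi>)) = L (\<lambda>t. m \<phi> (t + s))"
      using that by (intro agree bd PD) (auto simp: m_shift)
    also have "\<dots> = L (m \<phi>)" using that by (intro L_shift bd) auto
    finally show ?thesis using that by (simp add: rep PD \<Lambda>_def)
  qed
  then have "invariant_measure X \<rho> P \<mu>"
    using sets_\<mu> int_\<mu> \<Lambda>.prob_space_measure_rep by (simp add: invariant_measure_def \<mu>_def)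
  then show ?thesis by blast
qed

theorem proposition2p4:
  fixes P :: "real \<Rightarrow> (('y::banach \<Rightarrow>\<^sub>L real) \<Rightarrow> real) \<Rightarrow> ('y \<Rightarrow>\<^sub>L real) \<Rightarrow> real"
    and M :: "'w measure"
    and \<xi> :: "real \<Rightarrow> 'w \<Rightarrow> ('y \<Rightarrow>\<^sub>L real)"
  assumes "generalised_feller_process weak_star dual_weight P M \<xi>"
    and "(SUP t\<in>{0..}. \<integral>\<^sup>+ \<omega>. ennreal (norm (\<xi> t \<omega>)) \<partial>M) < \<infinity>"
  shows "\<exists>\<mu>. invariant_measure weak_star dual_weight P \<mu>"
proof -
  obtain b where b: "0 \<le> b" "(SUP t\<in>{0..}. \<integral>\<^sup>+ \<omega>. ennreal (norm (\<xi> t \<omega>)) \<partial>M) = ennreal b"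
    using assms(2) by (cases "SUP t\<in>{0..}. \<integral>\<^sup>+ \<omega>. ennreal (norm (\<xi> t \<omega>)) \<partial>M") auto
  interpret prob_space M using assms(1) by (simp add: generalised_feller_process_def)
  have "(\<integral>\<^sup>+ \<omega>. ennreal (dual_weight (\<xi> t \<omega>)) \<partial>M) \<le> ennreal (1 + b)" if t: "0 \<le> t" for t
  proof -
    have "\<xi> t \<in> measurable M (borel_algebra weak_star)"
      using assms(1) t by (simp add: generalised_feller_process_def)
    from measurable_compose[OF this admissible_weight_measurable[OF admissible_dual_weight]]
    \<comment> \<open>The norm is measurable for the weak-star Borel sets because the weight is.\<close>
    have "(\<lambda>\<omega>. dual_weight (\<xi> t \<omega>) - 1) \<in> borel_measurable M" by simp
    then have meas: "(\<lambda>\<omega>. norm (\<xi> t \<omega>)) \<in> borel_measurable M" by (simp add: dual_weight_def)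
    have "(\<integral>\<^sup>+ \<omega>. ennreal (norm (\<xi> t \<omega>)) \<partial>M) \<le> ennreal b"
      unfolding b(2)[symmetric] using t by (intro SUP_upper) simp
    moreover have "(\<integral>\<^sup>+ \<omega>. ennreal (dual_weight (\<xi> t \<omega>)) \<partial>M)
        = 1 + (\<integral>\<^sup>+ \<omega>. ennreal (norm (\<xi> t \<omega>)) \<partial>M)"
      using meas by (simp add: dual_weight_def ennreal_plus nn_integral_add emeasure_space_1)
    ultimately show ?thesis using b(1) by (simp add: ennreal_plus add_left_mono)
  qed
  then show ?thesis
    using generalised_feller_process_invariant_measure[OF admissible_dual_weight assms(1), of "1 + b"] b(1)
    by simp
qed

end
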